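(* Let $\mathsf{k}$ be a field and let $G$ be a finite simple graph which is triangle free and is not a forest. Let $G^c$ be the complement of $G$ and $S=\mathsf{k}[V(G)]$. Then $\operatorname{reg}(S/I(G^c))=2$.
   Context: For a finite simple graph $H$ with vertex set $V(H)$ and edge set $E(H)$, the vertices are regarded as variables, and the edge ideal is $I(H)=(xy:\{x,y\}\in E(H))$ in the standard graded polynomial ring $\mathsf{k}[V(H)]$. The complement $G^c$ is the graph on $V(G)$ whose edges are the pairs $\{x,y\}$, $x\ne y$, that are not edges of $G$. The (Castelnuovo-Mumford) regularity is $\operatorname{reg}(S/I)=\max\{j:\operatorname{Tor}_i^S(S/I,\mathsf{k})_{i+j}\neq0\text{ for some }i\ge0\}$. *)

theory Defs
  imports
    "HOL-Library.Poly_Mapping"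
    "HOL-Library.Ramsey"
    "Jordan_Normal_Form.Matrix_Kernel"
begin

section \<open>Finite simple graphs\<close>

text \<open>
  A graph on the vertex set \<open>UNIV :: 'v set\<close> (with \<open>'v\<close> finite) is given by its set of edges,
  each edge being a two-element set of vertices.
\<close>

definition simple_graph :: "'v set set \<Rightarrow> bool" where
  "simple_graph E \<longleftrightarrow> E \<subseteq> [UNIV]\<^bsup>2\<^esup>"

definition graph_complement :: "'v set set \<Rightarrow> 'v set set" where
  "graph_complement E = [UNIV]\<^bsup>2\<^esup> - E"

definition triangle_free :: "'v set set \<Rightarrow> bool" where
  "triangle_free E \<longleftrightarrow>
     \<not> (\<exists>x y z. x \<noteq> y \<and> y \<noteq> z \<and> x \<noteq> z \<and> {x, y} \<in> E \<and> {y, z} \<in> E \<and> {x, z} \<in> E)"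

definition graph_cycle :: "'v set set \<Rightarrow> 'v list \<Rightarrow> bool" where
  "graph_cycle E c \<longleftrightarrow> 3 \<le> length c \<and> distinct c \<and>
     (\<forall>i < length c. {c ! i, c ! (Suc i mod length c)} \<in> E)"

definition forest :: "'v set set \<Rightarrow> bool" where
  "forest E \<longleftrightarrow> \<not> (\<exists>c. graph_cycle E c)"


section \<open>The standard graded polynomial ring\<close>

text \<open>
  A monomial is a finitely supported exponent vector, and a polynomial is a finitely supported
  family of coefficients indexed by monomials; multiplication is convolution.
\<close>

type_synonym ('v, 'k) mpoly = "('v \<Rightarrow>\<^sub>0 nat) \<Rightarrow>\<^sub>0 'k"

definition mvar :: "'v \<Rightarrow> ('v, 'k::zero_neq_one) mpoly" where
  "mvar x = Poly_Mapping.single (Poly_Mapping.single x 1) 1"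

definition mon_degree :: "('v \<Rightarrow>\<^sub>0 nat) \<Rightarrow> nat" where
  "mon_degree m = (\<Sum>x \<in> Poly_Mapping.keys m. Poly_Mapping.lookup m x)"

text \<open>The zero polynomial is homogeneous of every degree, and the only one in degrees \<open>d < 0\<close>.\<close>

definition homogeneous :: "int \<Rightarrow> ('v, 'k::zero) mpoly \<Rightarrow> bool" where
  "homogeneous d p \<longleftrightarrow> (\<forall>m \<in> Poly_Mapping.keys p. int (mon_degree m) = d)"

definition ideal_gen :: "'a::comm_ring_1 set \<Rightarrow> 'a set" where
  "ideal_gen B = Modules.module.span (*) B"

definition edge_ideal :: "'v set set \<Rightarrow> ('v, 'k::field) mpoly set" where
  "edge_ideal E = ideal_gen {mvar x * mvar y | x y. {x, y} \<in> E}"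

definition irrelevant_ideal :: "('v, 'k::field) mpoly set" where
  "irrelevant_ideal = ideal_gen (range mvar)"


section \<open>Graded free resolutions, Tor and regularity\<close>

text \<open>
  A list of integers \<open>ds = [d\<^sub>0, \<dots>, d\<^sub>n\<^sub>-\<^sub>1]\<close> stands for the graded free module
  \<open>F = S(-d\<^sub>0) \<oplus> \<dots> \<oplus> S(-d\<^sub>n\<^sub>-\<^sub>1)\<close>, whose elements are the vectors of length \<open>n\<close> over \<open>S\<close> and
  whose \<open>b\<close>-th basis vector has degree \<open>d\<^sub>b\<close>.
\<close>

definition free_mod :: "int list \<Rightarrow> ('v, 'k::field) mpoly vec set" where
  "free_mod ds = carrier_vec (length ds)"

definition free_mod_degree :: "int list \<Rightarrow> int \<Rightarrow> ('v, 'k::field) mpoly vec set" where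
  "free_mod_degree ds d = {v \<in> free_mod ds. \<forall>b < length ds. homogeneous (d - ds ! b) (v $ b)}"

text \<open>The matrices of degree-preserving linear maps from the module given by \<open>cs\<close> to that given by \<open>rs\<close>.\<close>

definition graded_mat :: "int list \<Rightarrow> int list \<Rightarrow> ('v, 'k::field) mpoly mat set" where
  "graded_mat rs cs = {A \<in> carrier_mat (length rs) (length cs).
     \<forall>a < length rs. \<forall>b < length cs. homogeneous (cs ! b - rs ! a) (A $$ (a, b))}"

definition mat_image :: "'a::comm_ring_1 mat \<Rightarrow> 'a vec set" where
  "mat_image A = (\<lambda>v. A *\<^sub>v v) ` carrier_vec (dim_col A)"

text \<open>
  Graded free resolutions \<open>\<dots> \<rightarrow> F\<^sub>2 \<rightarrow> F\<^sub>1 \<rightarrow> F\<^sub>0 \<rightarrow> S/I \<rightarrow> 0\<close> with all \<open>F\<^sub>i\<close> of finite rank. Here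
  \<open>F\<^sub>i\<close> is given by \<open>ds i\<close>, the matrix \<open>D i\<close> is that of \<open>F\<^sub>i\<^sub>+\<^sub>1 \<rightarrow> F\<^sub>i\<close>, and the augmentation
  \<open>F\<^sub>0 \<rightarrow> S/I\<close> sends \<open>v\<close> to the class of \<open>e \<bullet> v\<close>. The ideal \<open>I\<close> is meant to be homogeneous.
\<close>

definition graded_free_resolution ::
  "('v, 'k::field) mpoly set \<Rightarrow> (nat \<Rightarrow> int list) \<Rightarrow> (nat \<Rightarrow> ('v, 'k) mpoly mat) \<Rightarrow>
   ('v, 'k) mpoly vec \<Rightarrow> bool" where
  "graded_free_resolution I ds D e \<longleftrightarrow>
     (\<forall>i. D i \<in> graded_mat (ds i) (ds (Suc i))) \<and>
     e \<in> carrier_vec (length (ds 0)) \<and> (\<forall>b < length (ds 0). homogeneous (ds 0 ! b) (e $ b)) \<and>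
     (\<forall>p. \<exists>v \<in> free_mod (ds 0). p - e \<bullet> v \<in> I) \<and>
     mat_image (D 0) = {v \<in> free_mod (ds 0). e \<bullet> v \<in> I} \<and>
     (\<forall>i. mat_image (D (Suc i)) = mat_kernel (D i))"

text \<open>
  The complex \<open>F \<otimes> S/J\<close> has the terms \<open>F\<^sub>i / J F\<^sub>i\<close>. Its cycles and boundaries in homological
  degree \<open>i\<close> are represented by their preimages in \<open>F\<^sub>i\<close>, so that both contain \<open>J F\<^sub>i\<close>.
\<close>

definition tensor_cycles ::
  "('v, 'k::field) mpoly set \<Rightarrow> (nat \<Rightarrow> int list) \<Rightarrow> (nat \<Rightarrow> ('v, 'k) mpoly mat) \<Rightarrow>
   nat \<Rightarrow> ('v, 'k) mpoly vec set" where
  "tensor_cycles J ds D i = (case i of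
       0 \<Rightarrow> free_mod (ds 0)
     | Suc i' \<Rightarrow> {v \<in> free_mod (ds i). \<forall>a < length (ds i'). (D i' *\<^sub>v v) $ a \<in> J})"

definition tensor_boundaries ::
  "('v, 'k::field) mpoly set \<Rightarrow> (nat \<Rightarrow> int list) \<Rightarrow> (nat \<Rightarrow> ('v, 'k) mpoly mat) \<Rightarrow>
   nat \<Rightarrow> ('v, 'k) mpoly vec set" where
  "tensor_boundaries J ds D i =
     {v \<in> free_mod (ds i). \<exists>w \<in> mat_image (D i). \<forall>b < length (ds i). v $ b - w $ b \<in> J}"

text \<open>
  \<open>tor_nonzero I J i d\<close> says \<open>Tor\<^sub>i(S/I, S/J)\<^sub>d \<noteq> 0\<close> for homogeneous ideals \<open>I\<close> and \<open>J\<close>: some cycle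
  of \<open>F \<otimes> S/J\<close> of internal degree \<open>d\<close> is not a boundary, where \<open>F\<close> is a graded free resolution of
  \<open>S/I\<close>. As Tor does not depend on the choice of \<open>F\<close>, quantifying existentially over \<open>F\<close> is the same
  as fixing one.
\<close>

definition tor_nonzero ::
  "('v, 'k::field) mpoly set \<Rightarrow> ('v, 'k) mpoly set \<Rightarrow> nat \<Rightarrow> int \<Rightarrow> bool" where
  "tor_nonzero I J i d \<longleftrightarrow> (\<exists>ds D e. graded_free_resolution I ds D e \<and>
     (\<exists>v \<in> free_mod_degree (ds i) d. v \<in> tensor_cycles J ds D i \<and> v \<notin> tensor_boundaries J ds D i))"

text \<open>
  The regularity of \<open>S/I\<close>, with the residue field written as \<open>S\<close> modulo its irrelevant ideal.
  \<open>GREATEST\<close> is only meaningful when the maximum exists, as it does for proper homogeneous \<open>I\<close>.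
\<close>

definition reg_quotient :: "('v::finite, 'k::field) mpoly set \<Rightarrow> int" where
  "reg_quotient I = (GREATEST j. \<exists>i. tor_nonzero I irrelevant_ideal i (int i + j))"

end

(* In a fixed multidegree the Taylor complex of a family of squarefree monomials is the chain complex of a
   full simplex, so it is contracted by coning with any generator that divides the multidegree.
   For the variables this gives the exactness of the Koszul complex K, for the edges of a graph E a
   graded free resolution of S/I(E). A zigzag in the double complex of K and an arbitrary resolution
   identifies Tor_i(S/I, k)_d with the homology of K over S/I.

   Let E be the complement of the triangle-free graph G. In multidegrees that are not squarefree the
   homology of K over S/I vanishes by the cone argument. In squarefree multidegrees d <= i + 2, because
   a monomial outside I is supported on a vertex or an edge of G. A cycle of length n in G supports a
   nonzero class of homological degree n - 2 and internal degree n. *)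

theory Submission
  imports Defs "HOL-Library.Function_Algebras"
begin

section \<open>Simplicial chains with signs\<close>

text \<open>\<open>tor_nonzero\<close> quantifies existentially over resolutions, so the upper bound
  on the regularity has to hold for whichever resolution is presented, while nonvanishing asks for a
  single one. This is why the comparison with the Koszul complex is made for an arbitrary
  resolution, and why an explicit resolution is still constructed. Only the existence of a nonzero
  class is carried through the double complex; no total complex and no isomorphism of homology
  groups is formed. The cone vertex is chosen anew in every multidegree. The resulting homotopy is
  in general not S-linear, but it preserves multidegrees, which is all that exactness and
  homogeneity ask for. It may also be switched off in some multidegrees, so that the same map
  contracts just the non-squarefree part of the Koszul complex over S/I. Exactness of a resolution
  speaks of all vectors, whereas Tor is graded. Preimages are therefore projected to the required
  degree, which commutes with graded matrices.\<close>

definition sgn_at :: "'g::countable \<Rightarrow> 'g set \<Rightarrow> 'k::comm_ring_1" where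
  "sgn_at j S = (-1) ^ card {i \<in> S. to_nat i < to_nat j}"

lemma sgn_at_square [simp]: "sgn_at j S * sgn_at j S = 1"
  by (simp add: sgn_at_def flip: power_mult_distrib)

lemma sgn_at_square' [simp]: "sgn_at j S * (sgn_at j S * x) = x"
  by (simp flip: mult.assoc)

lemma sgn_at_insert:
  assumes "finite S" "i \<notin> S" "i \<noteq> j"
  shows "sgn_at j (insert i S) = (if to_nat i < to_nat j then - sgn_at j S else sgn_at j S)"
proof -
  have "{l \<in> insert i S. to_nat l < to_nat j}
      = (if to_nat i < to_nat j then insert i {l \<in> S. to_nat l < to_nat j} else {l \<in> S. to_nat l < to_nat j})"
    by auto
  then show ?thesis using assms by (simp add: sgn_at_def)
qed

text \<open>Whichever of \<open>i\<close> and \<open>j\<close> comes first in the order given by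
  \<open>to_nat\<close>, exactly one of the two insertions flips a sign. Both \<open>d d = 0\<close>
  and the cone identity rest on this.\<close>

lemma sgn_at_anticommute:
  assumes "finite S" "i \<notin> S" "j \<notin> S" "i \<noteq> j"
  shows "sgn_at j S * sgn_at i (insert j S) = - (sgn_at i S * sgn_at j (insert i S))"
proof -
  have "to_nat i \<noteq> to_nat j" using assms by simp
  then show ?thesis using assms by (auto simp: sgn_at_insert not_less)
qed

text \<open>The boundary operator read off on coefficients: the value at \<open>S\<close> collects
  the cofaces of \<open>S\<close>. The empty set counts as a simplex, so the complex is augmented
  and a nonempty full simplex is acyclic in every degree.\<close>

definition simplicial_diff ::
  "'g::finite set \<Rightarrow> ('g set \<Rightarrow> 'k::comm_ring_1) \<Rightarrow> 'g set \<Rightarrow> 'k" where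
  "simplicial_diff A g S = (\<Sum>j\<in>A - S. sgn_at j S * g (insert j S))"

definition simplicial_cone :: "'g::finite \<Rightarrow> ('g set \<Rightarrow> 'k::comm_ring_1) \<Rightarrow> 'g set \<Rightarrow> 'k" where
  "simplicial_cone j g S = (if j \<in> S then sgn_at j (S - {j}) * g (S - {j}) else 0)"

text \<open>The terms at \<open>(i, j)\<close> and \<open>(j, i)\<close> cancel. Splitting the pairs
  by \<open>to_nat\<close> avoids the argument that the sum equals its own negative, which proves
  nothing in characteristic two.\<close>

lemma sum_alternating_eq_0:
  fixes f :: "'a::countable \<Rightarrow> 'a \<Rightarrow> 'b::ab_group_add"
  assumes "finite B" "\<And>i j. i \<in> B \<Longrightarrow> j \<in> B \<Longrightarrow> i \<noteq> j \<Longrightarrow> f i j = - f j i"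
  shows "(\<Sum>i\<in>B. \<Sum>j\<in>B - {i}. f i j) = 0"
proof -
  let ?L = "{(i, j). i \<in> B \<and> j \<in> B \<and> to_nat i < to_nat j}"
  let ?U = "{(i, j). i \<in> B \<and> j \<in> B \<and> to_nat j < to_nat i}"
  have fin: "finite ?L" "finite ?U"
    by (rule finite_subset[of _ "B \<times> B"]; use assms(1) in auto)+
  have "(\<Sum>i\<in>B. \<Sum>j\<in>B - {i}. f i j) = (\<Sum>(i, j)\<in>Sigma B (\<lambda>i. B - {i}). f i j)"
    using assms(1) by (intro sum.Sigma) auto
  also have "Sigma B (\<lambda>i. B - {i}) = ?L \<union> ?U"
  proof -
    have "i \<noteq> j \<longleftrightarrow> to_nat i < to_nat j \<or> to_nat j < to_nat i" for i j :: 'a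
      by (simp flip: nat_neq_iff)
    then show ?thesis by auto
  qed
  also have "(\<Sum>(i, j)\<in>\<dots>. f i j) = (\<Sum>(i, j)\<in>?L. f i j) + (\<Sum>(i, j)\<in>?U. f i j)"
    using fin by (intro sum.union_disjoint) auto
  also have "(\<Sum>(i, j)\<in>?U. f i j) = (\<Sum>(i, j)\<in>?L. f j i)"
    by (rule sum.reindex_bij_witness[of _ "\<lambda>(i, j). (j, i)" "\<lambda>(i, j). (j, i)"]) auto
  also have "\<dots> = (\<Sum>(i, j)\<in>?L. - f i j)"
    using assms(2) by (intro sum.cong) auto
  finally show ?thesis by (simp add: sum_negf case_prod_unfold)
qed

lemma simplicial_diff_diff:
  fixes g :: "'g::finite set \<Rightarrow> 'k::comm_ring_1"
  shows "simplicial_diff A (simplicial_diff A g) S = 0"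
proof -
  have "simplicial_diff A (simplicial_diff A g) S
     = (\<Sum>j\<in>A - S. \<Sum>i\<in>(A - S) - {j}. sgn_at j S * sgn_at i (insert j S) * g (insert i (insert j S)))"
    by (auto simp: simplicial_diff_def sum_distrib_left mult.assoc insert_commute intro!: sum.cong)
  also have "\<dots> = 0"
  proof (rule sum_alternating_eq_0)
    fix j i assume "j \<in> A - S" "i \<in> A - S" "j \<noteq> i"
    then have "sgn_at j S * sgn_at i (insert j S) = - (sgn_at i S * (sgn_at j (insert i S) :: 'k))"
      by (intro sgn_at_anticommute) auto
    then show "sgn_at j S * sgn_at i (insert j S) * g (insert i (insert j S)) =
        - (sgn_at i S * sgn_at j (insert i S) * g (insert j (insert i S)))"
      by (simp add: insert_commute)
  qed simp
  finally show ?thesis .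
qed

text \<open>If \<open>j\<close> is not in \<open>S\<close>, only the summand adding \<open>j\<close>
  survives. If it is, the summand restoring \<open>j\<close> gives \<open>g S\<close> and the others
  cancel by anticommutation.\<close>

lemma simplicial_diff_cone:
  fixes g :: "'g::finite set \<Rightarrow> 'k::comm_ring_1"
  assumes "j \<in> A"
  shows "simplicial_diff A (simplicial_cone j g) S + simplicial_cone j (simplicial_diff A g) S = g S"
proof (cases "j \<in> S")
  case False
  have "simplicial_diff A (simplicial_cone j g) S = (\<Sum>i\<in>A - S. if i = j then g S else 0)"
    unfolding simplicial_diff_def simplicial_cone_def using False by (intro sum.cong) (auto simp: )
  then show ?thesis using False assms by (simp add: simplicial_cone_def)
next
  case True
  define R where "R = S - {j}"
  have S: "S = insert j R" "j \<notin> R" using True by (auto simp: R_def)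
  have ins: "insert i S - {j} = insert i R" if "i \<noteq> j" for i using that S by auto
  have "simplicial_cone j (simplicial_diff A g) S
      = sgn_at j R * (\<Sum>i\<in>A - R. sgn_at i R * g (insert i R))"
    using True by (simp add: simplicial_cone_def simplicial_diff_def R_def)
  also have "A - R = insert j (A - S)" using assms S by auto
  also have "(\<Sum>i\<in>\<dots>. sgn_at i R * g (insert i R))
    = sgn_at j R * g S + (\<Sum>i\<in>A - S. sgn_at i R * g (insert i R))"
    using S by (subst sum.insert) auto
  finally have 1: "simplicial_cone j (simplicial_diff A g) S =
     g S + (\<Sum>i\<in>A - S. sgn_at j R * (sgn_at i R * g (insert i R)))"
    by (simp add: distrib_left sum_distrib_left)
  have "simplicial_diff A (simplicial_cone j g) S = (\<Sum>i\<in>A - S. sgn_at i S * (sgn_at j (insert i R) * g (insert i R)))"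
    unfolding simplicial_diff_def simplicial_cone_def
  proof (intro sum.cong refl)
    fix i assume "i \<in> A - S"
    then have "i \<noteq> j" using True by auto
    then show "sgn_at i S * (if j \<in> insert i S then sgn_at j (insert i S - {j}) * g (insert i S - {j}) else 0)
        = sgn_at i S * (sgn_at j (insert i R) * g (insert i R))"
      using True by (simp add: ins)
  qed
  also have "\<dots> = (\<Sum>i\<in>A - S. - (sgn_at j R * (sgn_at i R * g (insert i R))))"
  proof (intro sum.cong refl)
    fix i assume "i \<in> A - S"
    then have i: "i \<notin> R" "i \<noteq> j" using S by auto
    \<comment> \<open>The square of \<open>sgn_at j R\<close> is inserted to produce the left side
      of \<open>sgn_at_anticommute\<close>.\<close>
    have "sgn_at i S * sgn_at j (insert i R)
      = sgn_at j R * (sgn_at j R * sgn_at i (insert j R)) * (sgn_at j (insert i R) :: 'k)"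
      by (simp add: S)
    also have "\<dots> = - sgn_at j R * sgn_at i R * (sgn_at j (insert i R) * sgn_at j (insert i R))"
      using i S by (subst sgn_at_anticommute) (auto simp: mult.assoc)
    finally have "sgn_at i S * sgn_at j (insert i R) = - sgn_at j R * (sgn_at i R :: 'k)" by simp
    then show "sgn_at i S * (sgn_at j (insert i R) * g (insert i R)) = - (sgn_at j R * (sgn_at i R * g (insert i R)))"
      by (metis mult.assoc mult_minus_left)
  qed
  finally show ?thesis using 1 by (simp add: sum_negf)
qed

section \<open>Monomials\<close>

definition sqfree :: "'v::finite set \<Rightarrow> ('v \<Rightarrow>\<^sub>0 nat)" where
  "sqfree W = Abs_poly_mapping (\<lambda>v. if v \<in> W then 1 else 0)"

lemma lookup_sqfree [simp]: "Poly_Mapping.lookup (sqfree W) v = (if v \<in> W then 1 else 0)"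
  unfolding sqfree_def by (subst lookup_Abs_poly_mapping) auto

lemma keys_sqfree [simp]: "Poly_Mapping.keys (sqfree W) = W"
  by (auto simp: in_keys_iff split: if_splits)

lemma sqfree_empty [simp]: "sqfree {} = 0"
  by (rule poly_mapping_eqI) simp

lemma mon_degree_eq: "mon_degree m = (\<Sum>v\<in>UNIV. Poly_Mapping.lookup m v)"
  for m :: "'v::finite \<Rightarrow>\<^sub>0 nat"
  unfolding mon_degree_def by (rule sum.mono_neutral_left) (auto simp: in_keys_iff)

lemma mon_degree_add: "mon_degree (m + n) = mon_degree m + mon_degree n"
  for m n :: "'v::finite \<Rightarrow>\<^sub>0 nat"
  by (simp add: mon_degree_eq lookup_add sum.distrib)

lemma mon_degree_sqfree [simp]: "mon_degree (sqfree W) = card W"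
  by (simp add: mon_degree_def)

lemma add_diff_sqfree:
  assumes "W \<subseteq> Poly_Mapping.keys n" shows "sqfree W + (n - sqfree W) = n"
  using assms by (intro poly_mapping_eqI) (auto simp: lookup_add lookup_minus in_keys_iff Suc_le_eq)

lemma lookup_single_times_add:
  fixes p :: "'m::cancel_comm_monoid_add \<Rightarrow>\<^sub>0 'k::semiring_0"
  shows "Poly_Mapping.lookup (Poly_Mapping.single m c * p) (m + n) = c * Poly_Mapping.lookup p n"
  by (simp add: lookup_mult lookup_single when_mult Sum_any_right_distrib mult_when)

lemma lookup_single_times_not_add:
  fixes p :: "'m::cancel_comm_monoid_add \<Rightarrow>\<^sub>0 'k::semiring_0"
  assumes "\<nexists>n'. n = m + n'"
  shows "Poly_Mapping.lookup (Poly_Mapping.single m c * p) n = 0"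
proof (rule ccontr)
  assume "\<not> ?thesis"
  then have "n \<in> Poly_Mapping.keys (Poly_Mapping.single m c * p)" by (simp add: in_keys_iff)
  then show False using keys_mult[of "Poly_Mapping.single m c" p] assms by (fastforce split: if_splits)
qed

lemma lookup_sqfree_times:
  "Poly_Mapping.lookup (Poly_Mapping.single (sqfree W) c * p) n
     = (if W \<subseteq> Poly_Mapping.keys n then c * Poly_Mapping.lookup p (n - sqfree W) else 0)"
  for p :: "('v::finite, 'k::semiring_0) mpoly"
proof (cases "W \<subseteq> Poly_Mapping.keys n")
  case True
  then show ?thesis using lookup_single_times_add[of "sqfree W" c p "n - sqfree W"] by (simp add: add_diff_sqfree)
next
  case False
  then have "\<nexists>n'. n = sqfree W + n'" by (auto simp: in_keys_iff lookup_add)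
  then show ?thesis using False by (simp add: lookup_single_times_not_add)
qed

section \<open>The Taylor complex of squarefree monomials\<close>

text \<open>The monomial is the quotient of the least common multiples belonging to
  \<open>insert j S\<close> and \<open>S\<close>. Singletons \<open>U v = {v}\<close> give the
  Koszul complex, \<open>U e = e\<close> on edges the Taylor complex of an edge ideal.\<close>

definition taylor_diff ::
  "('g::finite \<Rightarrow> 'v::finite set) \<Rightarrow> 'g set \<Rightarrow> ('g set \<Rightarrow> ('v, 'k::comm_ring_1) mpoly) \<Rightarrow> 'g set \<Rightarrow> ('v, 'k) mpoly" where
  "taylor_diff U A f S =
     (\<Sum>j\<in>A - S. Poly_Mapping.single (sqfree (U j - \<Union>(U ` S))) (sgn_at j S) * f (insert j S))"

text \<open>\<open>c\<close> names the cone vertex of each multidegree, and \<open>None\<close>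
  makes the map zero there. The argument of \<open>c\<close> is the multidegree of the term with
  exponent \<open>n\<close> at \<open>S\<close>; the exponent looked up at \<open>S - {j}\<close> is
  the one of the same multidegree.\<close>

definition taylor_homotopy ::
  "('g::finite \<Rightarrow> 'v::finite set) \<Rightarrow> (('v \<Rightarrow>\<^sub>0 nat) \<Rightarrow> 'g option) \<Rightarrow>
   ('g set \<Rightarrow> ('v, 'k::comm_ring_1) mpoly) \<Rightarrow> 'g set \<Rightarrow> ('v, 'k) mpoly" where
  "taylor_homotopy U c f S = Abs_poly_mapping (\<lambda>n. case c (n + sqfree (\<Union>(U ` S))) of None \<Rightarrow> 0 | Some j \<Rightarrow>
     if j \<in> S then sgn_at j (S - {j}) * Poly_Mapping.lookup (f (S - {j})) (n + sqfree (U j - \<Union>(U ` (S - {j})))) else 0)"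

text \<open>The coefficient of \<open>f\<close> at the basis vector of \<open>S\<close> in the multidegree \<open>a\<close>, where the basis vector
  itself has the multidegree of the least common multiple of the generators in \<open>S\<close>. In a fixed
  multidegree the Taylor differential becomes the simplicial one.\<close>

definition multicoeff ::
  "('g::finite \<Rightarrow> 'v::finite set) \<Rightarrow> ('g set \<Rightarrow> ('v, 'k::zero) mpoly) \<Rightarrow> ('v \<Rightarrow>\<^sub>0 nat) \<Rightarrow> 'g set \<Rightarrow> 'k" where
  "multicoeff U f a S = (if \<Union>(U ` S) \<subseteq> Poly_Mapping.keys a
     then Poly_Mapping.lookup (f S) (a - sqfree (\<Union>(U ` S))) else 0)"

lemma lookup_eq_multicoeff:
  "Poly_Mapping.lookup (f S) n = multicoeff U f (n + sqfree (\<Union>(U ` S))) S"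
  by (auto simp: multicoeff_def in_keys_iff lookup_add)

lemma multicoeff_eqI: "(\<And>a. multicoeff U f a S = multicoeff U g a S) \<Longrightarrow> f S = g S"
  by (rule poly_mapping_eqI) (simp add: lookup_eq_multicoeff[of _ S _ U])

lemma diff_sqfree_sqfree: "a - sqfree W - sqfree (V - W) = a - sqfree (W \<union> V)"
  by (rule poly_mapping_eqI) (auto simp: lookup_minus)

lemma multicoeff_taylor_diff:
  "multicoeff U (taylor_diff U A f) a S = simplicial_diff A (multicoeff U f a) S"
proof (cases "\<Union>(U ` S) \<subseteq> Poly_Mapping.keys a")
  case False
  then have "multicoeff U f a (insert j S) = 0" for j by (auto simp: multicoeff_def)
  then show ?thesis using False by (simp add: multicoeff_def[of U "taylor_diff U A f"] simplicial_diff_def)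
next
  case True
  have "Poly_Mapping.lookup (Poly_Mapping.single (sqfree (U j - \<Union>(U ` S))) (sgn_at j S) * f (insert j S)) (a - sqfree (\<Union>(U ` S)))
      = sgn_at j S * multicoeff U f a (insert j S)" for j
  proof -
    \<comment> \<open>Subtracting the monomial of \<open>S\<close> changes no exponent outside its
      support, so divisibility can be tested on \<open>a\<close> itself.\<close>
    have "U j - \<Union>(U ` S) \<subseteq> Poly_Mapping.keys (a - sqfree (\<Union>(U ` S))) \<longleftrightarrow> U j \<subseteq> Poly_Mapping.keys a"
    proof -
      have "v \<in> Poly_Mapping.keys (a - sqfree (\<Union>(U ` S))) \<longleftrightarrow> v \<in> Poly_Mapping.keys a" if "v \<notin> \<Union>(U ` S)" for v
        using that by (simp add: in_keys_iff lookup_minus)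
      then show ?thesis using True by blast
    qed
    then show ?thesis using True
      by (simp add: lookup_sqfree_times multicoeff_def diff_sqfree_sqfree Un_commute)
  qed
  then show ?thesis using True
    by (simp add: multicoeff_def[of U "taylor_diff U A f"] simplicial_diff_def taylor_diff_def lookup_sum)
qed

lemma taylor_diff_diff: "taylor_diff U A (taylor_diff U A f) S = 0"
proof -
  have "taylor_diff U A (taylor_diff U A f) S = (\<lambda>_. 0) S"
  proof (rule multicoeff_eqI[of U])
    fix a
    have "multicoeff U (taylor_diff U A f) a = simplicial_diff A (multicoeff U f a)"
      by (intro ext) (simp add: multicoeff_taylor_diff)
    then show "multicoeff U (taylor_diff U A (taylor_diff U A f)) a S = multicoeff U (\<lambda>_. 0) a S"
      by (simp add: multicoeff_taylor_diff simplicial_diff_diff multicoeff_def[of U "\<lambda>_. 0"])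
  qed
  then show ?thesis by simp
qed

lemma lookup_taylor_homotopy:
  "Poly_Mapping.lookup (taylor_homotopy U c f S) n = (case c (n + sqfree (\<Union>(U ` S))) of None \<Rightarrow> 0 | Some j \<Rightarrow>
     if j \<in> S then sgn_at j (S - {j}) * Poly_Mapping.lookup (f (S - {j})) (n + sqfree (U j - \<Union>(U ` (S - {j})))) else 0)"
proof -
  let ?g = "\<lambda>n. case c (n + sqfree (\<Union>(U ` S))) of None \<Rightarrow> 0 | Some j \<Rightarrow>
     if j \<in> S then sgn_at j (S - {j}) * Poly_Mapping.lookup (f (S - {j})) (n + sqfree (U j - \<Union>(U ` (S - {j})))) else 0"
  \<comment> \<open>However \<open>c\<close> is chosen, each \<open>j\<close> in \<open>S\<close>
    contributes at most the preimage of a finite set under an injective translation.\<close>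
  have "{n. ?g n \<noteq> 0} \<subseteq> (\<Union>j\<in>S. (\<lambda>n. n + sqfree (U j - \<Union>(U ` (S - {j})))) -` Poly_Mapping.keys (f (S - {j})))"
    by (auto simp: in_keys_iff split: option.splits if_splits)
  moreover have "finite \<dots>"
    by (intro finite_UN_I finite_vimageI) (auto intro: injI)
  ultimately have "finite {n. ?g n \<noteq> 0}" by (rule finite_subset)
  then show ?thesis unfolding taylor_homotopy_def by (rule fun_cong[OF lookup_Abs_poly_mapping])
qed

text \<open>The hypothesis keeps the cone inside the simplices that divide \<open>a\<close>: when
  \<open>j\<close> divides \<open>a\<close>, the sets \<open>S\<close> and \<open>S - {j}\<close>
  divide \<open>a\<close> or fail to do so together.\<close>

lemma multicoeff_taylor_homotopy:
  assumes "\<And>j. c a = Some j \<Longrightarrow> U j \<subseteq> Poly_Mapping.keys a"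
  shows "multicoeff U (taylor_homotopy U c f) a S
     = (case c a of None \<Rightarrow> 0 | Some j \<Rightarrow> simplicial_cone j (multicoeff U f a) S)"
proof (cases "\<Union>(U ` S) \<subseteq> Poly_Mapping.keys a")
  case True
  have a: "a - sqfree (\<Union>(U ` S)) + sqfree (\<Union>(U ` S)) = a"
    using add_diff_sqfree[OF True] by (simp add: add.commute)
  have "a - sqfree (\<Union>(U ` S)) + sqfree (U j - \<Union>(U ` (S - {j}))) = a - sqfree (\<Union>(U ` (S - {j})))"
    if "j \<in> S" for j
  proof -
    have "\<Union>(U ` S) = U j \<union> \<Union>(U ` (S - {j}))" using that by auto
    then show ?thesis using True
      by (intro poly_mapping_eqI) (auto simp: lookup_minus lookup_add in_keys_iff Suc_le_eq)
  qed
  moreover have "\<Union>(U ` (S - {j})) \<subseteq> Poly_Mapping.keys a" for j using True by auto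
  ultimately show ?thesis using True a
    by (auto simp: multicoeff_def lookup_taylor_homotopy simplicial_cone_def split: option.splits)
next
  case False
  have "multicoeff U f a (S - {j}) = 0" if "c a = Some j" "j \<in> S" for j
  proof -
    have "\<Union>(U ` S) = U j \<union> \<Union>(U ` (S - {j}))" using that by auto
    with False assms[OF that(1)] show ?thesis by (auto simp: multicoeff_def)
  qed
  with False show ?thesis by (auto simp: multicoeff_def[of U "taylor_homotopy U c f"] simplicial_cone_def split: option.splits)
qed

lemma taylor_homotopy_identity:
  fixes f :: "'g::finite set \<Rightarrow> ('v::finite, 'k::comm_ring_1) mpoly"
  assumes "c a = Some j" "j \<in> A" "U j \<subseteq> Poly_Mapping.keys a"
  shows "multicoeff U (taylor_diff U A (taylor_homotopy U c f)) a S
       + multicoeff U (taylor_homotopy U c (taylor_diff U A f)) a S = multicoeff U f a S"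
proof -
  have "multicoeff U (taylor_homotopy U c f) a = simplicial_cone j (multicoeff U f a)" for f :: "'g set \<Rightarrow> ('v, 'k) mpoly"
    using assms by (intro ext, subst multicoeff_taylor_homotopy) auto
  moreover have "multicoeff U (taylor_diff U A f) a = simplicial_diff A (multicoeff U f a)"
    by (intro ext) (simp add: multicoeff_taylor_diff)
  ultimately show ?thesis using assms(2) by (simp add: multicoeff_taylor_diff simplicial_diff_cone)
qed

section \<open>Homogeneous polynomials\<close>

lemma homogeneous_0 [simp]: "homogeneous d 0"
  by (simp add: homogeneous_def)

lemma homogeneous_sum: "(\<And>x. x \<in> B \<Longrightarrow> homogeneous d (f x)) \<Longrightarrow> homogeneous d (sum f B)"
proof (induction B rule: infinite_finite_induct)
  case (insert x B)
  then show ?case using keys_add[of "f x" "sum f B"] by (fastforce simp: homogeneous_def)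
qed auto

lemma homogeneous_diff:
  fixes p q :: "('v, 'k::ab_group_add) mpoly"
  assumes "homogeneous d p" "homogeneous d q"
  shows "homogeneous d (p - q)"
  unfolding homogeneous_def
proof
  fix n assume "n \<in> Poly_Mapping.keys (p - q)"
  then have "n \<in> Poly_Mapping.keys p \<or> n \<in> Poly_Mapping.keys q" by (auto simp: in_keys_iff lookup_minus)
  then show "int (mon_degree n) = d" using assms by (auto simp: homogeneous_def)
qed

lemma homogeneous_mult:
  fixes p q :: "('v::finite, 'k::semiring_0) mpoly"
  assumes "homogeneous d p" "homogeneous e q"
  shows "homogeneous (d + e) (p * q)"
  unfolding homogeneous_def
proof
  fix n assume "n \<in> Poly_Mapping.keys (p * q)"
  then obtain a b where "n = a + b" "a \<in> Poly_Mapping.keys p" "b \<in> Poly_Mapping.keys q"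
    using keys_mult[of p q] by blast
  then show "int (mon_degree n) = d + e" using assms by (auto simp: homogeneous_def mon_degree_add)
qed

lemma homogeneous_single: "int (mon_degree m) = d \<Longrightarrow> homogeneous d (Poly_Mapping.single m c)"
  by (simp add: homogeneous_def)

definition hcomp :: "int \<Rightarrow> ('v, 'k::zero) mpoly \<Rightarrow> ('v, 'k) mpoly" where
  "hcomp d p = Abs_poly_mapping (\<lambda>n. if int (mon_degree n) = d then Poly_Mapping.lookup p n else 0)"

lemma lookup_hcomp:
  "Poly_Mapping.lookup (hcomp d p) n = (if int (mon_degree n) = d then Poly_Mapping.lookup p n else 0)"
proof -
  have "finite {n. (if int (mon_degree n) = d then Poly_Mapping.lookup p n else 0) \<noteq> 0}"
    by (rule finite_subset[of _ "Poly_Mapping.keys p"]) (auto simp: in_keys_iff)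
  then show ?thesis unfolding hcomp_def by (rule fun_cong[OF lookup_Abs_poly_mapping])
qed

lemma homogeneous_hcomp [simp]: "homogeneous d (hcomp d p)"
  by (auto simp: homogeneous_def in_keys_iff lookup_hcomp split: if_splits)

lemma hcomp_homogeneous: "homogeneous d p \<Longrightarrow> hcomp d p = p"
  by (rule poly_mapping_eqI) (auto simp: lookup_hcomp homogeneous_def in_keys_iff)

lemma hcomp_0 [simp]: "hcomp d 0 = 0"
  by (rule poly_mapping_eqI) (simp add: lookup_hcomp)

lemma hcomp_diff: "hcomp d (p - q) = hcomp d p - hcomp d q"
  for p q :: "('v, 'k::ab_group_add) mpoly"
  by (rule poly_mapping_eqI) (simp add: lookup_hcomp lookup_minus)

lemma hcomp_sum: "hcomp d (sum f B) = (\<Sum>x\<in>B. hcomp d (f x))"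
  for f :: "'b \<Rightarrow> ('v, 'k::ab_group_add) mpoly"
  by (rule poly_mapping_eqI) (simp add: lookup_hcomp lookup_sum)

text \<open>A homogeneous factor shifts all degrees by \<open>e\<close>, so the part of
  \<open>p\<close> outside degree \<open>d - e\<close> contributes nothing to degree
  \<open>d\<close>.\<close>

lemma hcomp_mult:
  fixes p q :: "('v::finite, 'k::comm_ring_1) mpoly"
  assumes "homogeneous e q"
  shows "hcomp d (q * p) = q * hcomp (d - e) p"
proof (rule poly_mapping_eqI)
  fix n
  let ?r = "p - hcomp (d - e) p"
  have "q * p = q * hcomp (d - e) p + q * ?r" by (simp add: algebra_simps)
  then have eq: "Poly_Mapping.lookup (q * p) n
      = Poly_Mapping.lookup (q * hcomp (d - e) p) n + Poly_Mapping.lookup (q * ?r) n"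
    by (metis lookup_add)
  have hom: "homogeneous d (q * hcomp (d - e) p)"
    using homogeneous_mult[OF assms homogeneous_hcomp, of "d - e" p] by simp
  show "Poly_Mapping.lookup (hcomp d (q * p)) n = Poly_Mapping.lookup (q * hcomp (d - e) p) n"
  proof (cases "int (mon_degree n) = d")
    case True
    have "n \<notin> Poly_Mapping.keys (q * ?r)"
    proof
      assume "n \<in> Poly_Mapping.keys (q * ?r)"
      then obtain a b where ab: "n = a + b" "a \<in> Poly_Mapping.keys q" "b \<in> Poly_Mapping.keys ?r"
        using keys_mult[of q ?r] by blast
      then have "int (mon_degree b) = d - e"
        using True assms by (auto simp: homogeneous_def mon_degree_add)
      then show False using ab(3) by (simp add: in_keys_iff lookup_minus lookup_hcomp)
    qed
    then show ?thesis using True eq by (simp add: lookup_hcomp in_keys_iff)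
  next
    case False
    then show ?thesis using hom by (auto simp: lookup_hcomp homogeneous_def in_keys_iff)
  qed
qed

section \<open>Monomial ideals\<close>

interpretation ring_module: Modules.module "(*) :: 'a::comm_ring_1 \<Rightarrow> 'a \<Rightarrow> 'a"
  by unfold_locales (simp_all add: algebra_simps)

lemma sum_single_lookup:
  "(\<Sum>n\<in>Poly_Mapping.keys p. Poly_Mapping.single n (Poly_Mapping.lookup p n)) = p"
  for p :: "'a \<Rightarrow>\<^sub>0 'b::comm_monoid_add"
proof (rule poly_mapping_eqI)
  fix m
  have "(\<Sum>n\<in>Poly_Mapping.keys p. Poly_Mapping.lookup (Poly_Mapping.single n (Poly_Mapping.lookup p n)) m)
     = (\<Sum>n\<in>Poly_Mapping.keys p. if n = m then Poly_Mapping.lookup p m else 0)"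
    by (intro sum.cong) (auto simp: lookup_single when_def)
  then show "Poly_Mapping.lookup (\<Sum>n\<in>Poly_Mapping.keys p. Poly_Mapping.single n (Poly_Mapping.lookup p n)) m
     = Poly_Mapping.lookup p m"
    by (simp add: lookup_sum in_keys_iff)
qed

text \<open>A multiple of a monomial has only terms divisible by it; conversely, each term with a
  divisor in \<open>M\<close> is by itself a multiple of a generator.\<close>

lemma monomial_ideal_iff:
  fixes p :: "('v::finite, 'k::comm_ring_1) mpoly"
  shows "p \<in> ideal_gen ((\<lambda>m. Poly_Mapping.single m 1) ` M)
    \<longleftrightarrow> (\<forall>n\<in>Poly_Mapping.keys p. \<exists>m\<in>M. \<exists>n'. n = m + n')"
proof
  assume "p \<in> ideal_gen ((\<lambda>m. Poly_Mapping.single m 1) ` M)"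
  then show "\<forall>n\<in>Poly_Mapping.keys p. \<exists>m\<in>M. \<exists>n'. n = m + n'"
    unfolding ideal_gen_def
  proof (induction rule: ring_module.span_induct_alt)
    case base
    then show ?case by simp
  next
    case (step c x y)
    then obtain m where m: "m \<in> M" "x = Poly_Mapping.single m 1" by auto
    have "Poly_Mapping.keys (c * x + y) \<subseteq> Poly_Mapping.keys (x * c) \<union> Poly_Mapping.keys y"
      by (simp add: keys_add mult.commute)
    moreover have "\<exists>n'. n = m + n'" if "n \<in> Poly_Mapping.keys (x * c)" for n
      using that lookup_single_times_not_add[of n m 1 c] m by (auto simp: in_keys_iff)
    ultimately show ?case using step m by blast
  qed
next
  assume *: "\<forall>n\<in>Poly_Mapping.keys p. \<exists>m\<in>M. \<exists>n'. n = m + n'"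
  have "Poly_Mapping.single n c \<in> ideal_gen ((\<lambda>m. Poly_Mapping.single m 1) ` M)"
    if "n \<in> Poly_Mapping.keys p" for n and c :: 'k
  proof -
    obtain m n' where m: "m \<in> M" "n = m + n'" using * \<open>n \<in> _\<close> by blast
    have "Poly_Mapping.single n c = Poly_Mapping.single n' c * Poly_Mapping.single m 1"
      using m by (simp add: mult_single add.commute)
    then show ?thesis using m unfolding ideal_gen_def
      by (metis (no_types, lifting) image_eqI ring_module.span_base ring_module.span_scale)
  qed
  then have "(\<Sum>n\<in>Poly_Mapping.keys p. Poly_Mapping.single n (Poly_Mapping.lookup p n))
      \<in> ideal_gen ((\<lambda>m. Poly_Mapping.single m 1) ` M)"
    unfolding ideal_gen_def by (intro ring_module.span_sum)
  then show "p \<in> ideal_gen ((\<lambda>m. Poly_Mapping.single m 1) ` M)" by (simp add: sum_single_lookup)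
qed

lemma ex_add_sqfree_iff: "(\<exists>n'. n = sqfree W + n') \<longleftrightarrow> W \<subseteq> Poly_Mapping.keys n"
proof
  assume "\<exists>n'. n = sqfree W + n'"
  then show "W \<subseteq> Poly_Mapping.keys n" by (auto simp: in_keys_iff lookup_add)
next
  assume "W \<subseteq> Poly_Mapping.keys n"
  then show "\<exists>n'. n = sqfree W + n'" by (metis add_diff_sqfree)
qed

lemma sqfree_single: "Poly_Mapping.single x 1 = sqfree {x}"
  by (rule poly_mapping_eqI) (auto simp: lookup_single)

lemma edge_ideal_iff:
  fixes p :: "('v::finite, 'k::field) mpoly"
  assumes "simple_graph E"
  shows "p \<in> edge_ideal E \<longleftrightarrow> (\<forall>n\<in>Poly_Mapping.keys p. \<exists>e\<in>E. e \<subseteq> Poly_Mapping.keys n)"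
proof -
  have edge: "x \<noteq> y" if "{x, y} \<in> E" for x y
    using that assms by (auto simp: simple_graph_def nsets_def)
  have "mvar x * mvar y = (Poly_Mapping.single (sqfree {x, y}) 1 :: ('v, 'k) mpoly)" if "{x, y} \<in> E" for x y
  proof -
    have "Poly_Mapping.single x 1 + Poly_Mapping.single y 1 = sqfree {x, y}"
      using edge[OF that] by (intro poly_mapping_eqI) (auto simp: lookup_add lookup_single)
    then show ?thesis by (simp add: mvar_def mult_single)
  qed
  moreover have "\<exists>x y. e = {x, y}" if "e \<in> E" for e
    using that assms by (auto simp: simple_graph_def nsets_def card_2_iff) blast
  ultimately have "{mvar x * mvar y | x y. {x, y} \<in> E}
      = (\<lambda>m. Poly_Mapping.single m 1 :: ('v, 'k) mpoly) ` sqfree ` E"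
    by (force simp: image_image)
  then show ?thesis
    by (simp add: edge_ideal_def monomial_ideal_iff ex_add_sqfree_iff)
qed

lemma irrelevant_ideal_iff:
  fixes p :: "('v::finite, 'k::field) mpoly"
  shows "p \<in> irrelevant_ideal \<longleftrightarrow> Poly_Mapping.lookup p 0 = 0"
proof -
  have "range mvar = (\<lambda>m. Poly_Mapping.single m 1 :: ('v, 'k) mpoly) ` range (\<lambda>x. sqfree {x})"
    by (simp add: mvar_def sqfree_single image_image del: One_nat_def)
  moreover have "(\<exists>x. x \<in> Poly_Mapping.keys n) \<longleftrightarrow> n \<noteq> 0" for n :: "'v \<Rightarrow>\<^sub>0 nat"
    by (metis keys_zero poly_mapping_eqI in_keys_iff empty_iff lookup_zero)
  ultimately have "p \<in> irrelevant_ideal \<longleftrightarrow> (\<forall>n\<in>Poly_Mapping.keys p. n \<noteq> 0)"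
    by (simp add: irrelevant_ideal_def monomial_ideal_iff ex_add_sqfree_iff)
  then show ?thesis by (metis in_keys_iff)
qed

section \<open>Chains of the Taylor complex\<close>

definition taylor_chain :: "'g set \<Rightarrow> nat \<Rightarrow> ('g set \<Rightarrow> 'a::zero) \<Rightarrow> bool" where
  "taylor_chain A p f \<longleftrightarrow> (\<forall>S. f S \<noteq> 0 \<longrightarrow> S \<subseteq> A \<and> card S = p)"

definition taylor_homogeneous ::
  "('g \<Rightarrow> 'v set) \<Rightarrow> int \<Rightarrow> ('g set \<Rightarrow> ('v, 'k::zero) mpoly) \<Rightarrow> bool" where
  "taylor_homogeneous U d f \<longleftrightarrow> (\<forall>S. homogeneous (d - int (card (\<Union>(U ` S)))) (f S))"

lemma taylor_chain_diff:
  fixes U :: "'g::finite \<Rightarrow> 'v::finite set"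
  assumes "taylor_chain A (Suc p) f"
  shows "taylor_chain A p (taylor_diff U A f)"
  unfolding taylor_chain_def
proof (intro allI impI)
  fix S assume "taylor_diff U A f S \<noteq> 0"
  then obtain j where "j \<in> A - S" "f (insert j S) \<noteq> 0"
    unfolding taylor_diff_def by (metis (no_types, lifting) mult_zero_right sum.neutral)
  then have "insert j S \<subseteq> A" "card (insert j S) = Suc p" "j \<notin> S" using assms by (auto simp: taylor_chain_def)
  then show "S \<subseteq> A \<and> card S = p" by simp
qed

lemma taylor_homogeneous_diff:
  fixes U :: "'g::finite \<Rightarrow> 'v::finite set" and f :: "'g set \<Rightarrow> ('v, 'k::comm_ring_1) mpoly"
  assumes "taylor_homogeneous U d f"
  shows "taylor_homogeneous U d (taylor_diff U A f)"
  unfolding taylor_homogeneous_def taylor_diff_def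
proof (intro allI homogeneous_sum)
  fix S j
  let ?V = "\<Union>(U ` S)"
  have V: "\<Union>(U ` insert j S) = ?V \<union> (U j - ?V)" by auto
  have "card (?V \<union> (U j - ?V)) = card ?V + card (U j - ?V)"
    by (rule card_Un_disjoint) auto
  moreover have "homogeneous (d - int (card (?V \<union> (U j - ?V)))) (f (insert j S))"
    using assms unfolding taylor_homogeneous_def V[symmetric] by blast
  then have "homogeneous (int (card (U j - ?V)) + (d - int (card (?V \<union> (U j - ?V)))))
     (Poly_Mapping.single (sqfree (U j - ?V)) (sgn_at j S) * f (insert j S))"
    by (intro homogeneous_mult homogeneous_single) simp_all
  ultimately show "homogeneous (d - int (card ?V))
     (Poly_Mapping.single (sqfree (U j - ?V)) (sgn_at j S) * f (insert j S))"
    by simp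
qed

lemma taylor_homotopy_nonzeroE:
  assumes "Poly_Mapping.lookup (taylor_homotopy U c f S) n \<noteq> 0"
  obtains j where "c (n + sqfree (\<Union>(U ` S))) = Some j" "j \<in> S"
    "Poly_Mapping.lookup (f (S - {j})) (n + sqfree (U j - \<Union>(U ` (S - {j})))) \<noteq> 0"
  using assms by (fastforce simp: lookup_taylor_homotopy split: option.splits if_splits)

lemma taylor_chain_homotopy:
  fixes U :: "'g::finite \<Rightarrow> 'v::finite set" and f :: "'g set \<Rightarrow> ('v, 'k::comm_ring_1) mpoly"
  assumes "taylor_chain A p f" "\<And>a j. c a = Some j \<Longrightarrow> j \<in> A"
  shows "taylor_chain A (Suc p) (taylor_homotopy U c f)"
  unfolding taylor_chain_def
proof (intro allI impI)
  fix S assume "taylor_homotopy U c f S \<noteq> 0"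
  then obtain n where "Poly_Mapping.lookup (taylor_homotopy U c f S) n \<noteq> 0"
    by (metis poly_mapping_eqI lookup_zero)
  then obtain j where j: "c (n + sqfree (\<Union>(U ` S))) = Some j" "j \<in> S" "f (S - {j}) \<noteq> 0"
    by (metis lookup_zero taylor_homotopy_nonzeroE)
  then have "S - {j} \<subseteq> A" "card (S - {j}) = p" "j \<in> A" using assms by (auto simp: taylor_chain_def)
  moreover have "card S = Suc (card (S - {j}))" using j(2) by (intro card.remove) auto
  ultimately show "S \<subseteq> A \<and> card S = Suc p" by auto
qed

lemma taylor_homogeneous_homotopy:
  fixes U :: "'g::finite \<Rightarrow> 'v::finite set" and f :: "'g set \<Rightarrow> ('v, 'k::comm_ring_1) mpoly"
  assumes "taylor_homogeneous U d f"
  shows "taylor_homogeneous U d (taylor_homotopy U c f)"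
  unfolding taylor_homogeneous_def homogeneous_def
proof (intro allI ballI)
  fix S n assume "n \<in> Poly_Mapping.keys (taylor_homotopy U c f S)"
  then have "Poly_Mapping.lookup (taylor_homotopy U c f S) n \<noteq> 0" by (simp add: in_keys_iff)
  then obtain j where j: "j \<in> S" "n + sqfree (U j - \<Union>(U ` (S - {j}))) \<in> Poly_Mapping.keys (f (S - {j}))"
    by (elim taylor_homotopy_nonzeroE) (auto simp: in_keys_iff)
  then have "int (mon_degree (n + sqfree (U j - \<Union>(U ` (S - {j}))))) = d - int (card (\<Union>(U ` (S - {j}))))"
    using assms by (auto simp: taylor_homogeneous_def homogeneous_def)
  moreover have "\<Union>(U ` S) = \<Union>(U ` (S - {j})) \<union> (U j - \<Union>(U ` (S - {j})))" using j by auto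
  then have "card (\<Union>(U ` S)) = card (\<Union>(U ` (S - {j}))) + card (U j - \<Union>(U ` (S - {j})))"
    by (metis Diff_disjoint card_Un_disjoint finite)
  ultimately show "int (mon_degree n) = d - int (card (\<Union>(U ` S)))"
    by (simp add: mon_degree_add)
qed

text \<open>By \<open>div\<close>, every multidegree in which \<open>f\<close> has a term offers a
  cone vertex, and there the homotopy identity for a cycle reads \<open>d h = f\<close>. The flag
  \<open>gr\<close> merges a graded and an ungraded version: Koszul chains carry a degree, while
  exactness of the Taylor matrices concerns arbitrary vectors.\<close>

lemma taylor_exact:
  fixes U :: "'g::finite \<Rightarrow> 'v::finite set" and f :: "'g set \<Rightarrow> ('v, 'k::comm_ring_1) mpoly"
  assumes "taylor_chain A p f"
    and "taylor_homogeneous U d f \<or> \<not> gr"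
    and cycle: "\<And>S. taylor_diff U A f S = 0"
    and div: "\<And>S n. n \<in> Poly_Mapping.keys (f S) \<Longrightarrow> \<exists>j\<in>A. U j \<subseteq> Poly_Mapping.keys (n + sqfree (\<Union>(U ` S)))"
  shows "\<exists>h. taylor_chain A (Suc p) h \<and> (gr \<longrightarrow> taylor_homogeneous U d h) \<and> taylor_diff U A h = f"
proof -
  define P where "P a j \<longleftrightarrow> j \<in> A \<and> U j \<subseteq> Poly_Mapping.keys a" for a :: "'v \<Rightarrow>\<^sub>0 nat" and j
  define c where "c a = (if \<exists>j. P a j then Some (SOME j. P a j) else None)" for a
  have c: "P a j" if "c a = Some j" for a j
    using that someI_ex[of "P a"] by (auto simp: c_def split: if_splits)
  let ?h = "taylor_homotopy U c f"
  have "taylor_diff U A ?h S = f S" for S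
  proof (rule multicoeff_eqI)
    fix a
    show "multicoeff U (taylor_diff U A ?h) a S = multicoeff U f a S"
    proof (cases "c a")
      \<comment> \<open>No generator divides \<open>a\<close>, so \<open>f\<close> has no
        coefficient in this multidegree either.\<close>
      case None
      then have "multicoeff U f a S' = 0" for S'
      proof -
        have "multicoeff U f a S' \<noteq> 0 \<Longrightarrow> \<exists>j. P a j"
          using div[of "a - sqfree (\<Union>(U ` S'))" S'] add_diff_sqfree[of "\<Union>(U ` S')" a]
          by (auto simp: multicoeff_def P_def in_keys_iff add.commute split: if_splits)
        then show ?thesis using None by (auto simp: c_def split: if_splits)
      qed
      moreover have "multicoeff U ?h a S' = 0" for S'
        by (subst multicoeff_taylor_homotopy) (use None c in \<open>auto simp: P_def\<close>)
      ultimately show ?thesis by (simp add: multicoeff_taylor_diff simplicial_diff_def)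
    next
      case (Some j)
      have "multicoeff U (taylor_homotopy U c (taylor_diff U A f)) a S = 0"
      proof -
        have "taylor_diff U A f = (\<lambda>_. 0)" using cycle by auto
        then show ?thesis by (simp add: multicoeff_def lookup_taylor_homotopy split: option.splits)
      qed
      then show ?thesis using taylor_homotopy_identity[of c a j A U f S] Some c[OF Some] by (simp add: P_def)
    qed
  qed
  then have "taylor_diff U A ?h = f" by auto
  moreover have "taylor_chain A (Suc p) ?h"
    using assms(1) c by (intro taylor_chain_homotopy) (auto simp: P_def)
  moreover have "gr \<longrightarrow> taylor_homogeneous U d ?h" using assms(2) by (auto intro: taylor_homogeneous_homotopy)
  ultimately show ?thesis by blast
qed

section \<open>Double complexes with exact rows and columns\<close>

text \<open>Exactness is assumed at positive indices only; what fails at index 0 is the homology to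
  be compared. The squares commute without signs, as no total complex is formed.\<close>

locale double_complex =
  fixes X :: "nat \<Rightarrow> nat \<Rightarrow> 'a::ab_group_add set"
    and d D :: "nat \<Rightarrow> 'a \<Rightarrow> 'a"
  assumes diff_closed: "x \<in> X p q \<Longrightarrow> y \<in> X p q \<Longrightarrow> x - y \<in> X p q"
    and d_closed: "x \<in> X (Suc p) q \<Longrightarrow> d p x \<in> X p q"
    and D_closed: "x \<in> X p (Suc q) \<Longrightarrow> D q x \<in> X p q"
    and d_diff: "d p (x - y) = d p x - d p y"
    and D_diff: "D q (x - y) = D q x - D q y"
    and d_exact: "x \<in> X (Suc p) q \<Longrightarrow> d p x = 0 \<longleftrightarrow> (\<exists>u\<in>X (Suc (Suc p)) q. x = d (Suc p) u)"
    and D_exact: "x \<in> X p (Suc q) \<Longrightarrow> D q x = 0 \<longleftrightarrow> (\<exists>u\<in>X p (Suc (Suc q)). x = D (Suc q) u)"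
    and d_D: "d p (D q x) = D q (d p x)"
begin

lemma transposed: "double_complex (\<lambda>p q. X q p) D d"
  by unfold_locales (auto simp: diff_closed d_closed D_closed d_diff D_diff d_exact D_exact d_D)

definition boundary :: "nat \<Rightarrow> nat \<Rightarrow> 'a \<Rightarrow> bool" where
  "boundary p q x \<longleftrightarrow> (\<exists>u\<in>X (Suc p) q. \<exists>t\<in>X p (Suc q). x = d p u + D q t)"

text \<open>Away from the two axes, either of the last two conditions says that \<open>d (D x) = 0\<close>.\<close>

definition homology_class :: "nat \<Rightarrow> nat \<Rightarrow> 'a \<Rightarrow> bool" where
  "homology_class p q x \<longleftrightarrow> x \<in> X p q \<and> \<not> boundary p q x \<and>
     (\<forall>q'. q = Suc q' \<longrightarrow> (\<exists>u\<in>X (Suc p) q'. D q' x = d p u)) \<and>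
     (\<forall>p'. p = Suc p' \<longrightarrow> (\<exists>t\<in>X p' (Suc q). d p' x = D q t))"

text \<open>The new class is a \<open>y\<close> with \<open>d y = D x\<close>. If
  \<open>y = d u + D t\<close>, then \<open>x - d t\<close> is a \<open>D\<close>-cycle, hence a
  \<open>D\<close>-boundary, and \<open>x\<close> would be a boundary.\<close>

lemma zigzag:
  assumes "homology_class p (Suc q) x"
  shows "\<exists>y. homology_class (Suc p) q y"
proof -
  obtain y where x: "x \<in> X p (Suc q)" "\<not> boundary p (Suc q) x"
    and y: "y \<in> X (Suc p) q" "D q x = d p y"
    using assms by (auto simp: homology_class_def)
  have "\<not> boundary (Suc p) q y"
  proof
    assume "boundary (Suc p) q y"
    then obtain u t where ut: "u \<in> X (Suc (Suc p)) q" "t \<in> X (Suc p) (Suc q)" "y = d (Suc p) u + D q t"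
      by (auto simp: boundary_def)
    have "y - D q t = d (Suc p) u" using ut by simp
    then have "d p (y - D q t) = 0" using d_exact[of "y - D q t" p q] ut y D_closed diff_closed by blast
    then have "D q (x - d p t) = 0" using y by (simp add: d_diff D_diff d_D)
    then obtain s where "s \<in> X p (Suc (Suc q))" "x - d p t = D (Suc q) s"
      using D_exact[of "x - d p t" p q] x ut diff_closed d_closed by blast
    then have "boundary p (Suc q) x" using ut unfolding boundary_def by (metis add.commute diff_add_cancel)
    then show False using x by blast
  qed
  moreover have "\<exists>u\<in>X (Suc (Suc p)) q'. D q' y = d (Suc p) u" if "q = Suc q'" for q'
  proof -
    have "D q' (D q x) = 0" using D_exact[of "D q x" p q'] D_closed x that by blast
    then have "d p (D q' y) = 0" using y by (simp add: d_D)
    then show ?thesis using d_exact D_closed y that by blast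
  qed
  \<comment> \<open>\<open>x\<close> itself witnesses the condition on \<open>d y\<close>.\<close>
  ultimately have "homology_class (Suc p) q y"
    using x(1) y(1) y(2)[symmetric] unfolding homology_class_def by blast
  then show ?thesis ..
qed

end

lemma (in double_complex) homology_class_transposed:
  "double_complex.homology_class (\<lambda>p q. X q p) D d q p x \<longleftrightarrow> homology_class p q x"
proof -
  interpret T: double_complex "\<lambda>p q. X q p" D d by (rule transposed)
  have "T.boundary q p x \<longleftrightarrow> boundary p q x"
    unfolding T.boundary_def boundary_def by (metis add.commute)
  then show ?thesis unfolding T.homology_class_def homology_class_def by auto
qed

text \<open>The converse is the same zigzag in the transposed complex.\<close>

lemma (in double_complex) homology_class_step:
  "(\<exists>x. homology_class p (Suc q) x) \<longleftrightarrow> (\<exists>y. homology_class (Suc p) q y)"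
proof -
  interpret T: double_complex "\<lambda>p q. X q p" D d by (rule transposed)
  show ?thesis using zigzag[of p q] T.zigzag[of q p] by (auto simp: homology_class_transposed)
qed

lemma (in double_complex) homology_class_shift:
  "(\<exists>x. homology_class p (q + i) x) \<longleftrightarrow> (\<exists>y. homology_class (p + i) q y)"
proof (induction i arbitrary: p)
  case (Suc i)
  show ?case using homology_class_step[of p "q + i"] Suc[of "Suc p"] by simp
qed simp

section \<open>Matrices acting on functions\<close>

text \<open>Functions on \<open>nat\<close> let free modules of all ranks live in one group type, as
  \<open>double_complex\<close> demands; values beyond the rank are set to zero.\<close>

definition mat_fun :: "'a::comm_ring_1 mat \<Rightarrow> (nat \<Rightarrow> 'a) \<Rightarrow> nat \<Rightarrow> 'a" where
  "mat_fun A u a = (if a < dim_row A then \<Sum>b<dim_col A. A $$ (a, b) * u b else 0)"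

lemma mat_fun_diff: "mat_fun A (u - v) = mat_fun A u - mat_fun A v"
  by (rule ext) (simp add: mat_fun_def algebra_simps sum_subtractf)

lemma mat_fun_zero [simp]: "mat_fun A (\<lambda>b. 0) = (\<lambda>a. 0)"
  by (auto simp: mat_fun_def)

lemma mult_mat_vec_mat_fun: "A *\<^sub>v v = vec (dim_row A) (mat_fun A (\<lambda>b. v $ b))" if "dim_vec v = dim_col A"
  using that by (intro eq_vecI) (auto simp: mat_fun_def scalar_prod_def lessThan_atLeast0 intro!: sum.cong)

lemma mat_fun_mult_mat_vec:
  "mat_fun A u a = (if a < dim_row A then (A *\<^sub>v vec (dim_col A) u) $ a else 0)"
  by (auto simp: mat_fun_def scalar_prod_def lessThan_atLeast0 intro!: sum.cong)

definition homog_part :: "int list \<Rightarrow> int \<Rightarrow> (nat \<Rightarrow> ('v, 'k::zero) mpoly) \<Rightarrow> nat \<Rightarrow> ('v, 'k) mpoly" where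
  "homog_part ds d u b = (if b < length ds then hcomp (d - ds ! b) (u b) else 0)"

lemma mat_fun_homog_part:
  fixes A :: "('v::finite, 'k::field) mpoly mat"
  assumes "A \<in> graded_mat rs cs"
  shows "mat_fun A (homog_part cs d u) = homog_part rs d (mat_fun A u)"
proof
  fix a
  have dims: "dim_row A = length rs" "dim_col A = length cs" using assms by (auto simp: graded_mat_def)
  show "mat_fun A (homog_part cs d u) a = homog_part rs d (mat_fun A u) a"
  proof (cases "a < length rs")
    case True
    have "A $$ (a, b) * hcomp (d - cs ! b) (u b) = hcomp (d - rs ! a) (A $$ (a, b) * u b)" if "b < length cs" for b
    proof -
      have "homogeneous (cs ! b - rs ! a) (A $$ (a, b))" using assms that True by (auto simp: graded_mat_def)
      from hcomp_mult[OF this, of "d - rs ! a" "u b"] show ?thesis by simp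
    qed
    then show ?thesis using True dims by (auto simp: mat_fun_def homog_part_def hcomp_sum intro!: sum.cong)
  qed (use dims in \<open>auto simp: mat_fun_def homog_part_def\<close>)
qed

section \<open>The Koszul complex\<close>

abbreviation koszul :: "('v::finite set \<Rightarrow> ('v, 'k::comm_ring_1) mpoly) \<Rightarrow> 'v set \<Rightarrow> ('v, 'k) mpoly" where
  "koszul \<equiv> taylor_diff (\<lambda>v. {v}) UNIV"

definition koszul_chain :: "nat \<Rightarrow> int \<Rightarrow> ('v::finite set \<Rightarrow> ('v, 'k::zero) mpoly) \<Rightarrow> bool" where
  "koszul_chain p d f \<longleftrightarrow> taylor_chain UNIV p f \<and> taylor_homogeneous (\<lambda>v. {v}) d f"

lemma koszul_chain_iff:
  "koszul_chain p d f \<longleftrightarrow> (\<forall>S. (f S \<noteq> 0 \<longrightarrow> card S = p) \<and> homogeneous (d - int p) (f S))"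
proof -
  have "homogeneous (d - int (card S)) (f S) \<longleftrightarrow> homogeneous (d - int p) (f S)" if "f S \<noteq> 0 \<longrightarrow> card S = p" for S
    using that by (cases "f S = 0") auto
  then show ?thesis unfolding koszul_chain_def taylor_chain_def taylor_homogeneous_def by auto
qed

lemma koszul_chain_koszul: "koszul_chain (Suc p) d f \<Longrightarrow> koszul_chain p d (koszul f)"
  by (auto simp: koszul_chain_def taylor_chain_diff taylor_homogeneous_diff)

text \<open>The only multidegree without a variable to cone with is 0, which occurs for the constant
  term at the empty set; the last hypothesis removes that term.\<close>

lemma koszul_exact:
  assumes "koszul_chain p d f" "\<And>S. koszul f S = 0" "p = 0 \<Longrightarrow> Poly_Mapping.lookup (f {}) 0 = 0"
  shows "\<exists>h. koszul_chain (Suc p) d h \<and> koszul h = f"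
proof -
  have "\<exists>j\<in>UNIV. {j} \<subseteq> Poly_Mapping.keys (n + sqfree (\<Union>v\<in>S. {v}))" if "n \<in> Poly_Mapping.keys (f S)" for n S
  proof -
    have "f S \<noteq> 0" using that by auto
    then have "card S = p" using assms(1) by (simp add: koszul_chain_iff)
    then have "S \<noteq> {} \<or> n \<noteq> 0" using that assms(3) by (auto simp: in_keys_iff)
    then obtain j where "j \<in> S \<or> j \<in> Poly_Mapping.keys n"
      by (metis keys_zero poly_mapping_eqI in_keys_iff empty_iff lookup_zero ex_in_conv)
    then show ?thesis by (auto simp: in_keys_iff lookup_add)
  qed
  then show ?thesis using assms(1,2) taylor_exact[of UNIV p f "\<lambda>v. {v}" d True]
    by (auto simp: koszul_chain_def)
qed

lemma koszul_diff: "koszul (\<lambda>T. f T - g T) S = koszul f S - koszul g S"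
  by (simp add: taylor_diff_def algebra_simps sum_subtractf)

lemma koszul_sum_mult: "koszul (\<lambda>T. \<Sum>b\<in>B. c b * f T b) S = (\<Sum>b\<in>B. c b * koszul (\<lambda>T. f T b) S)"
proof -
  have "koszul (\<lambda>T. \<Sum>b\<in>B. c b * f T b) S
      = (\<Sum>j\<in>UNIV - S. \<Sum>b\<in>B. c b * (Poly_Mapping.single (sqfree ({j} - (\<Union>v\<in>S. {v}))) (sgn_at j S) * f (insert j S) b))"
    unfolding taylor_diff_def sum_distrib_left by (simp only: mult.left_commute)
  also have "\<dots> = (\<Sum>b\<in>B. c b * koszul (\<lambda>T. f T b) S)"
    unfolding taylor_diff_def sum_distrib_left by (rule sum.swap)
  finally show ?thesis .
qed

lemma koszul_chain_diff: "koszul_chain p d f \<Longrightarrow> koszul_chain p d g \<Longrightarrow> koszul_chain p d (\<lambda>S. f S - g S)"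
  for f g :: "_ \<Rightarrow> ('v::finite, 'k::ab_group_add) mpoly"
  unfolding koszul_chain_iff by (metis diff_self homogeneous_diff)

lemma koszul_chain_0: "koszul_chain 0 d f \<Longrightarrow> koszul f S = 0"
proof -
  assume "koszul_chain 0 d f"
  then have "f (insert j S) = 0" for j by (auto simp: koszul_chain_iff)
  then show ?thesis by (simp add: taylor_diff_def)
qed

text \<open>Chains over \<open>S/I\<close> are represented by chains over \<open>S\<close>, with the
  cycle and boundary equations read modulo \<open>I\<close>, as in
  \<open>tensor_cycles\<close>.\<close>

definition koszul_homology_nonzero :: "('v::finite, 'k::comm_ring_1) mpoly set \<Rightarrow> nat \<Rightarrow> int \<Rightarrow> bool" where
  "koszul_homology_nonzero I i d \<longleftrightarrow> (\<exists>f. koszul_chain i d f \<and> (\<forall>S. koszul f S \<in> I) \<and>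
     \<not> (\<exists>h. koszul_chain (Suc i) d h \<and> (\<forall>S. f S - koszul h S \<in> I)))"

section \<open>Tor by resolutions and by the Koszul complex\<close>

locale graded_resolution =
  fixes I :: "('v::finite, 'k::field) mpoly set"
    and ds :: "nat \<Rightarrow> int list" and D :: "nat \<Rightarrow> ('v, 'k) mpoly mat" and e :: "('v, 'k) mpoly vec"
  assumes res: "graded_free_resolution I ds D e"
    and I_0: "0 \<in> I" and I_diff: "p \<in> I \<Longrightarrow> q \<in> I \<Longrightarrow> p - q \<in> I" and I_mult: "p \<in> I \<Longrightarrow> r * p \<in> I"
    and I_hcomp: "p \<in> I \<Longrightarrow> hcomp d p \<in> I"
begin

lemma I_add: "p \<in> I \<Longrightarrow> q \<in> I \<Longrightarrow> p + q \<in> I"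
  using I_diff[of p "0 - q"] I_diff[of 0 q] I_0 by simp

lemma I_sum: "(\<And>x. x \<in> B \<Longrightarrow> f x \<in> I) \<Longrightarrow> sum f B \<in> I"
  by (induction B rule: infinite_finite_induct) (auto intro: I_add I_0)

lemma I_koszul: "(\<And>T. f T \<in> I) \<Longrightarrow> koszul f S \<in> I"
  unfolding taylor_diff_def by (intro I_sum I_mult) auto

lemma D_graded: "D q \<in> graded_mat (ds q) (ds (Suc q))"
  using res by (simp add: graded_free_resolution_def)

lemma D_dims [simp]: "dim_row (D q) = length (ds q)" "dim_col (D q) = length (ds (Suc q))"
  using D_graded[of q] by (auto simp: graded_mat_def)

section \<open>Exactness of the resolution in terms of functions\<close>

definition supported :: "nat \<Rightarrow> (nat \<Rightarrow> ('v, 'k) mpoly) \<Rightarrow> bool" where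
  "supported q u \<longleftrightarrow> (\<forall>b\<ge>length (ds q). u b = 0)"

lemma supported_mat_fun [simp]: "supported q (mat_fun (D q) u)"
  by (simp add: supported_def mat_fun_def)

lemma mat_fun_image_iff:
  assumes "supported q u"
  shows "(\<exists>v. u = mat_fun (D q) v) \<longleftrightarrow> vec (length (ds q)) u \<in> mat_image (D q)"
proof
  assume "\<exists>v. u = mat_fun (D q) v"
  then obtain v where "u = mat_fun (D q) v" by blast
  then have "vec (length (ds q)) u = D q *\<^sub>v vec (length (ds (Suc q))) v"
    by (intro eq_vecI) (simp_all add: mat_fun_mult_mat_vec)
  then show "vec (length (ds q)) u \<in> mat_image (D q)" unfolding mat_image_def by auto
next
  assume "vec (length (ds q)) u \<in> mat_image (D q)"
  then obtain v where v: "v \<in> carrier_vec (length (ds (Suc q)))" "vec (length (ds q)) u = D q *\<^sub>v v"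
    by (auto simp: mat_image_def)
  have "u a = mat_fun (D q) (\<lambda>b. v $ b) a" for a
  proof (cases "a < length (ds q)")
    case True
    then have "u a = vec (length (ds q)) u $ a" by simp
    also have "\<dots> = mat_fun (D q) (\<lambda>b. v $ b) a"
      unfolding v(2) using v(1) True by (subst mult_mat_vec_mat_fun) auto
    finally show ?thesis .
  qed (use assms in \<open>auto simp: supported_def mat_fun_def\<close>)
  then show "\<exists>v. u = mat_fun (D q) v" by blast
qed

lemma mat_fun_kernel_iff:
  assumes "supported (Suc q) u"
  shows "mat_fun (D q) u = (\<lambda>_. 0) \<longleftrightarrow> (\<exists>v. u = mat_fun (D (Suc q)) v)"
proof -
  have "mat_image (D (Suc q)) = mat_kernel (D q)" using res by (simp add: graded_free_resolution_def)
  moreover have "mat_fun (D q) u = (\<lambda>_. 0) \<longleftrightarrow> vec (length (ds (Suc q))) u \<in> mat_kernel (D q)"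
    by (auto simp: mat_kernel_def fun_eq_iff mat_fun_mult_mat_vec vec_eq_iff)
  ultimately show ?thesis using assms by (simp add: mat_fun_image_iff)
qed

lemma mat_fun_mat_fun: "mat_fun (D q) (mat_fun (D (Suc q)) v) = (\<lambda>_. 0)"
  using mat_fun_kernel_iff[of q "mat_fun (D (Suc q)) v"] by auto

definition aug :: "(nat \<Rightarrow> ('v, 'k) mpoly) \<Rightarrow> ('v, 'k) mpoly" where
  "aug u = (\<Sum>b<length (ds 0). e $ b * u b)"

lemma aug_vec: "e \<bullet> vec (length (ds 0)) u = aug u"
  by (simp add: aug_def scalar_prod_def lessThan_atLeast0)

lemma aug_homog_part: "aug (homog_part (ds 0) d u) = hcomp d (aug u)"
proof -
  have "e $ b * hcomp (d - ds 0 ! b) (u b) = hcomp d (e $ b * u b)" if "b < length (ds 0)" for b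
    using res that hcomp_mult by (fastforce simp: graded_free_resolution_def)
  then show ?thesis by (simp add: aug_def homog_part_def hcomp_sum)
qed

lemma aug_in_I_iff:
  assumes "supported 0 u"
  shows "aug u \<in> I \<longleftrightarrow> (\<exists>v. u = mat_fun (D 0) v)"
proof -
  have "mat_image (D 0) = {v \<in> free_mod (ds 0). e \<bullet> v \<in> I}" using res by (simp add: graded_free_resolution_def)
  then show ?thesis using assms by (simp add: mat_fun_image_iff free_mod_def aug_vec)
qed

lemma aug_surj: "\<exists>u. p - aug u \<in> I"
proof -
  obtain v where v: "v \<in> free_mod (ds 0)" "p - e \<bullet> v \<in> I" using res unfolding graded_free_resolution_def by blast
  then have "v = vec (length (ds 0)) (\<lambda>b. v $ b)" by (auto simp: free_mod_def)
  with v(2) show ?thesis by (metis aug_vec)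
qed

text \<open>The part of internal degree \<open>d\<close> of the tensor product of the Koszul complex with the resolution.\<close>

definition X :: "int \<Rightarrow> nat \<Rightarrow> nat \<Rightarrow> ('v set \<Rightarrow> nat \<Rightarrow> ('v, 'k) mpoly) set" where
  "X d p q = {w. (\<forall>b<length (ds q). koszul_chain p (d - ds q ! b) (\<lambda>T. w T b)) \<and> (\<forall>T. supported q (w T))}"

definition dK :: "('v set \<Rightarrow> nat \<Rightarrow> ('v, 'k) mpoly) \<Rightarrow> 'v set \<Rightarrow> nat \<Rightarrow> ('v, 'k) mpoly" where
  "dK w T b = koszul (\<lambda>T. w T b) T"

definition dF :: "nat \<Rightarrow> ('v set \<Rightarrow> nat \<Rightarrow> ('v, 'k) mpoly) \<Rightarrow> 'v set \<Rightarrow> nat \<Rightarrow> ('v, 'k) mpoly" where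
  "dF q w T = mat_fun (D q) (w T)"

text \<open>The definition sorts coefficients by the basis of the free module, which suits
  \<open>dK\<close>; sorting them by the subset \<open>T\<close> suits \<open>dF\<close>.\<close>

lemma X_iff:
  "w \<in> X d p q \<longleftrightarrow> (\<forall>T. supported q (w T) \<and> (card T \<noteq> p \<longrightarrow> w T = (\<lambda>_. 0)) \<and> homog_part (ds q) (d - int p) (w T) = w T)"
proof
  assume w: "w \<in> X d p q"
  show "\<forall>T. supported q (w T) \<and> (card T \<noteq> p \<longrightarrow> w T = (\<lambda>_. 0)) \<and> homog_part (ds q) (d - int p) (w T) = w T"
  proof (intro allI conjI impI ext)
    fix T b
    show "supported q (w T)" using w by (simp add: X_def)
    show "homog_part (ds q) (d - int p) (w T) b = w T b"
      using w by (auto simp: X_def supported_def homog_part_def koszul_chain_iff algebra_simps intro!: hcomp_homogeneous)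
    assume "card T \<noteq> p"
    then show "w T b = 0" using w by (cases "b < length (ds q)") (auto simp: X_def supported_def koszul_chain_iff)
  qed
next
  assume *: "\<forall>T. supported q (w T) \<and> (card T \<noteq> p \<longrightarrow> w T = (\<lambda>_. 0)) \<and> homog_part (ds q) (d - int p) (w T) = w T"
  have "homogeneous (d - ds q ! b - int p) (w T b)" if "b < length (ds q)" for b T
  proof -
    have "w T b = hcomp (d - int p - ds q ! b) (w T b)" using * that by (metis homog_part_def)
    then show ?thesis by (metis homogeneous_hcomp diff_diff_eq add.commute)
  qed
  moreover have "w T b \<noteq> 0 \<Longrightarrow> card T = p" for T b using * by metis
  ultimately show "w \<in> X d p q" using * by (simp add: X_def koszul_chain_iff)
qed

lemma dK_closed: "w \<in> X d (Suc p) q \<Longrightarrow> dK w \<in> X d p q"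
proof -
  assume w: "w \<in> X d (Suc p) q"
  have "(\<lambda>T. dK w T b) = koszul (\<lambda>T. w T b)" for b by (simp add: dK_def)
  moreover have "dK w T b = 0" if "b \<ge> length (ds q)" for T b
    using w that by (simp add: X_def supported_def dK_def taylor_diff_def)
  ultimately show ?thesis using w by (simp add: X_def koszul_chain_koszul supported_def)
qed

lemma dF_closed: "w \<in> X d p (Suc q) \<Longrightarrow> dF q w \<in> X d p q"
  unfolding X_iff dF_def using D_graded mat_fun_homog_part by (metis mat_fun_zero supported_mat_fun)

text \<open>Exactness holds separately for each basis vector \<open>b\<close>. The case
  \<open>p = 0\<close> is included, with its condition on constant terms, in order to describe the
  image of \<open>dK\<close> in Koszul degree zero.\<close>

lemma dK_exact_aux:
  assumes w: "w \<in> X d p q" and "dK w = 0" "p = 0 \<Longrightarrow> (\<forall>b. Poly_Mapping.lookup (w {} b) 0 = 0)"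
  shows "\<exists>u\<in>X d (Suc p) q. w = dK u"
proof -
  have "\<exists>h. koszul_chain (Suc p) (d - ds q ! b) h \<and> koszul h = (\<lambda>T. w T b)" if "b < length (ds q)" for b
  proof (rule koszul_exact)
    show "koszul_chain p (d - ds q ! b) (\<lambda>T. w T b)" using w that by (simp add: X_def)
    show "koszul (\<lambda>T. w T b) S = 0" for S using assms(2) by (metis dK_def zero_fun_apply)
  qed (use assms(3) in auto)
  then obtain h where h: "\<And>b. b < length (ds q) \<Longrightarrow> koszul_chain (Suc p) (d - ds q ! b) (h b) \<and> koszul (h b) = (\<lambda>T. w T b)"
    by metis
  define u where "u T b = (if b < length (ds q) then h b T else 0)" for T b
  have "u \<in> X d (Suc p) q" using h by (auto simp: X_def u_def[abs_def] supported_def)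
  moreover have "w T b = dK u T b" for T b
    using h[of b] w by (cases "b < length (ds q)") (auto simp: dK_def u_def[abs_def] X_def supported_def taylor_diff_def dest: fun_cong)
  then have "w = dK u" by blast
  ultimately show ?thesis by blast
qed

lemma dK_exact:
  assumes "w \<in> X d (Suc p) q"
  shows "dK w = 0 \<longleftrightarrow> (\<exists>u\<in>X d (Suc (Suc p)) q. w = dK u)"
proof
  assume "\<exists>u\<in>X d (Suc (Suc p)) q. w = dK u"
  then obtain u where u: "w = dK u" by blast
  have "dK w T b = 0" for T b
    using taylor_diff_diff[of "\<lambda>v. {v}" UNIV "\<lambda>T. u T b" T] by (simp add: u dK_def[abs_def])
  then show "dK w = 0" by (simp add: fun_eq_iff)
qed (use dK_exact_aux[OF assms] in simp)

text \<open>Any preimage may be replaced by its homogeneous part.\<close>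

lemma dF_lift:
  assumes w: "w \<in> X d p q" and "\<And>T. \<exists>v. w T = mat_fun (D q) v"
  shows "\<exists>u\<in>X d p (Suc q). w = dF q u"
proof -
  obtain v where v: "\<And>T. w T = mat_fun (D q) (v T)" using assms(2) by metis
  define u where "u T = (if card T = p then homog_part (ds (Suc q)) (d - int p) (v T) else (\<lambda>_. 0))" for T
  have idem: "homog_part ds' n (homog_part ds' n f) = homog_part ds' n f" for ds' n and f :: "nat \<Rightarrow> ('v, 'k) mpoly"
    by (auto simp: homog_part_def hcomp_homogeneous)
  have "u \<in> X d p (Suc q)"
    unfolding X_iff u_def by (auto simp: idem supported_def) (auto simp: homog_part_def)
  moreover have "w T = dF q u T" for T
  proof (cases "card T = p")
    case True
    then have "dF q u T = homog_part (ds q) (d - int p) (w T)"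
      using v[of T] by (simp add: dF_def u_def mat_fun_homog_part[OF D_graded])
    then show ?thesis using w by (simp add: X_iff)
  qed (use w in \<open>auto simp: X_iff dF_def u_def\<close>)
  then have "w = dF q u" by blast
  ultimately show ?thesis by blast
qed

lemma dF_exact:
  assumes w: "w \<in> X d p (Suc q)"
  shows "dF q w = 0 \<longleftrightarrow> (\<exists>u\<in>X d p (Suc (Suc q)). w = dF (Suc q) u)"
proof
  assume "dF q w = 0"
  then have "mat_fun (D q) (w T) = (\<lambda>_. 0)" for T by (metis dF_def func_zero zero_fun_apply)
  then have "\<exists>v. w T = mat_fun (D (Suc q)) v" for T using w mat_fun_kernel_iff by (simp add: X_def)
  then show "\<exists>u\<in>X d p (Suc (Suc q)). w = dF (Suc q) u" using w dF_lift by blast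
next
  assume "\<exists>u\<in>X d p (Suc (Suc q)). w = dF (Suc q) u"
  then show "dF q w = 0" by (auto simp: dF_def[abs_def] mat_fun_mat_fun func_zero)
qed

lemma dK_dF: "dK (dF q w) = dF q (dK w)"
  by (auto simp: fun_eq_iff dK_def dF_def mat_fun_def koszul_sum_mult) (simp add: taylor_diff_def)

lemma X_diff: "x \<in> X d p q \<Longrightarrow> y \<in> X d p q \<Longrightarrow> x - y \<in> X d p q"
  by (auto simp: X_def supported_def koszul_chain_diff)

lemma dK_diff: "dK (x - y) = dK x - dK y"
  by (auto simp: fun_eq_iff dK_def koszul_diff)

lemma dF_diff: "dF q (x - y) = dF q x - dF q y"
  by (rule ext) (simp add: dF_def mat_fun_diff)

lemma double_complex: "double_complex (X d) (\<lambda>_. dK) dF"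
  by unfold_locales (simp_all add: X_diff dK_closed dF_closed dK_diff dF_diff dK_exact dF_exact dK_dF)

text \<open>In Koszul degree zero the cokernel of \<open>dK\<close> is the reduction modulo the
  variables. This turns conditions modulo \<open>irrelevant_ideal\<close> into those of
  \<open>homology_class\<close>.\<close>

lemma X_0_eq_dK_iff:
  assumes "w \<in> X d 0 q"
  shows "(\<exists>u\<in>X d 1 q. w = dK u) \<longleftrightarrow> (\<forall>b<length (ds q). w {} b \<in> irrelevant_ideal)"
proof
  assume "\<exists>u\<in>X d 1 q. w = dK u"
  then obtain u where u: "w = dK u" by blast
  show "\<forall>b<length (ds q). w {} b \<in> irrelevant_ideal"
    by (simp add: u irrelevant_ideal_iff dK_def taylor_diff_def lookup_sum lookup_sqfree_times)
next
  assume *: "\<forall>b<length (ds q). w {} b \<in> irrelevant_ideal"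
  have "dK w T b = 0" for T b
  proof -
    have "w (insert j T) = (\<lambda>_. 0)" for j using assms by (simp add: X_iff)
    then show ?thesis by (simp add: dK_def taylor_diff_def)
  qed
  then have "dK w = 0" by (simp add: fun_eq_iff)
  moreover have "Poly_Mapping.lookup (w {} b) 0 = 0" for b
    using * assms by (cases "b < length (ds q)") (auto simp: irrelevant_ideal_iff X_def supported_def)
  ultimately show "\<exists>u\<in>X d 1 q. w = dK u" using dK_exact_aux[OF assms] by simp
qed

section \<open>Tor as homology in Koszul degree zero\<close>

definition const_chain :: "nat \<Rightarrow> ('v, 'k) mpoly vec \<Rightarrow> 'v set \<Rightarrow> nat \<Rightarrow> ('v, 'k) mpoly" where
  "const_chain q v T b = (if T = {} \<and> b < length (ds q) then v $ b else 0)"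

lemma const_chain_in_X:
  assumes "v \<in> free_mod_degree (ds q) d" shows "const_chain q v \<in> X d 0 q"
  using assms by (auto simp: X_def koszul_chain_iff const_chain_def supported_def free_mod_degree_def)

lemma X_0_const_chain:
  assumes "w \<in> X d 0 q"
  obtains v where "v \<in> free_mod_degree (ds q) d" "w = const_chain q v"
proof
  show "vec (length (ds q)) (w {}) \<in> free_mod_degree (ds q) d"
    using assms by (auto simp: X_def koszul_chain_iff free_mod_degree_def free_mod_def)
  have "w T b = const_chain q (vec (length (ds q)) (w {})) T b" for T b
  proof (cases "b < length (ds q)")
    case True
    then have "w T b \<noteq> 0 \<longrightarrow> T = {}" using assms by (auto simp: X_def koszul_chain_iff)
    then show ?thesis using True by (auto simp: const_chain_def)
  qed (use assms in \<open>auto simp: X_def const_chain_def supported_def\<close>)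
  then show "w = const_chain q (vec (length (ds q)) (w {}))" by blast
qed

lemma tensor_cycles_iff:
  assumes v: "v \<in> free_mod_degree (ds i) d"
  shows "v \<in> tensor_cycles irrelevant_ideal ds D i
    \<longleftrightarrow> (\<forall>q. i = Suc q \<longrightarrow> (\<exists>u\<in>X d 1 q. dF q (const_chain i v) = dK u))"
proof (cases i)
  case 0
  then show ?thesis using v by (simp add: tensor_cycles_def free_mod_degree_def)
next
  case (Suc q)
  have fm: "v \<in> free_mod (ds i)" "dim_vec v = length (ds (Suc q))" using v Suc by (auto simp: free_mod_degree_def free_mod_def)
  have "dF q (const_chain i v) {} a = (D q *\<^sub>v v) $ a" if "a < length (ds q)" for a
    using that fm Suc by (subst mult_mat_vec_mat_fun) (auto simp: dF_def const_chain_def mat_fun_def)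
  moreover have "dF q (const_chain i v) \<in> X d 0 q" using const_chain_in_X[OF v] Suc dF_closed by simp
  ultimately show ?thesis using fm Suc
    by (auto simp: tensor_cycles_def X_0_eq_dK_iff[of _ d q] simp del: index_mult_mat_vec One_nat_def)
qed

lemma tensor_boundaries_iff:
  assumes v: "v \<in> free_mod_degree (ds i) d"
  shows "v \<in> tensor_boundaries irrelevant_ideal ds D i
    \<longleftrightarrow> (\<exists>u\<in>X d 1 i. \<exists>t\<in>X d 0 (Suc i). const_chain i v = dK u + dF i t)"
proof
  let ?w = "const_chain i v"
  have w: "?w \<in> X d 0 i" by (rule const_chain_in_X[OF v])
  assume "v \<in> tensor_boundaries irrelevant_ideal ds D i"
  then obtain z where z: "z \<in> carrier_vec (length (ds (Suc i)))"
    and m: "\<And>b. b < length (ds i) \<Longrightarrow> v $ b - (D i *\<^sub>v z) $ b \<in> irrelevant_ideal"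
    by (auto simp: tensor_boundaries_def mat_image_def)
  \<comment> \<open>The vector \<open>z\<close> need not be homogeneous; its part of degree
    \<open>d\<close> does the same service, because \<open>v\<close> has degree
    \<open>d\<close>.\<close>
  define t where "t T = (if T = {} then homog_part (ds (Suc i)) d (\<lambda>b. z $ b) else (\<lambda>_. 0))" for T :: "'v set"
  have t: "t \<in> X d 0 (Suc i)"
    unfolding X_iff t_def by (auto simp: supported_def homog_part_def hcomp_homogeneous)
  have "(?w - dF i t) {} b \<in> irrelevant_ideal" if "b < length (ds i)" for b
  proof -
    have "(D i *\<^sub>v z) $ b = mat_fun (D i) (\<lambda>b. z $ b) b"
      using z that by (subst mult_mat_vec_mat_fun) auto
    then have "Poly_Mapping.lookup (hcomp (d - ds i ! b) (v $ b) - hcomp (d - ds i ! b) (mat_fun (D i) (\<lambda>b. z $ b) b)) 0 = 0"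
      using m[OF that] by (simp add: irrelevant_ideal_iff lookup_minus lookup_hcomp)
    moreover have "dF i t {} b = hcomp (d - ds i ! b) (mat_fun (D i) (\<lambda>b. z $ b) b)"
      using that by (simp add: dF_def t_def mat_fun_homog_part[OF D_graded]) (simp add: homog_part_def)
    moreover have "?w {} b = hcomp (d - ds i ! b) (v $ b)"
      using that v by (simp add: const_chain_def free_mod_degree_def hcomp_homogeneous)
    ultimately show ?thesis by (simp add: irrelevant_ideal_iff)
  qed
  moreover have "?w - dF i t \<in> X d 0 i" using w t by (intro X_diff dF_closed)
  ultimately obtain u where u: "u \<in> X d 1 i" "?w - dF i t = dK u" using X_0_eq_dK_iff by blast
  from u(2) have "?w = dK u + dF i t" by (simp add: diff_eq_eq)
  with u t show "\<exists>u\<in>X d 1 i. \<exists>t\<in>X d 0 (Suc i). ?w = dK u + dF i t" by blast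
next
  assume "\<exists>u\<in>X d 1 i. \<exists>t\<in>X d 0 (Suc i). const_chain i v = dK u + dF i t"
  then obtain u t where ut: "u \<in> X d 1 i" "t \<in> X d 0 (Suc i)" "const_chain i v = dK u + dF i t" by blast
  let ?z = "vec (length (ds (Suc i))) (t {})"
  have "v $ b - (D i *\<^sub>v ?z) $ b \<in> irrelevant_ideal" if "b < length (ds i)" for b
  proof -
    have "dK u \<in> X d 0 i" using ut(1) dK_closed by simp
    then have "dK u {} b \<in> irrelevant_ideal" using X_0_eq_dK_iff ut(1) that by blast
    moreover have "v $ b = const_chain i v {} b" using that by (simp add: const_chain_def)
    moreover have "(D i *\<^sub>v ?z) $ b = dF i t {} b" using that by (simp add: dF_def mat_fun_mult_mat_vec)
    ultimately show ?thesis by (simp add: ut(3))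
  qed
  moreover have "D i *\<^sub>v ?z \<in> mat_image (D i)" by (auto simp: mat_image_def)
  moreover have "v \<in> free_mod (ds i)" using v by (simp add: free_mod_degree_def)
  ultimately show "v \<in> tensor_boundaries irrelevant_ideal ds D i" unfolding tensor_boundaries_def by blast
qed

text \<open>At \<open>(0, i)\<close> the condition on \<open>p\<close> is vacuous, and the remaining
  ones are the cycle and boundary conditions of the resolution modulo the image of
  \<open>dK\<close>.\<close>

lemma tor_iff_homology_class:
  "(\<exists>v\<in>free_mod_degree (ds i) d. v \<in> tensor_cycles irrelevant_ideal ds D i \<and> v \<notin> tensor_boundaries irrelevant_ideal ds D i)
   \<longleftrightarrow> (\<exists>w. double_complex.homology_class (X d) (\<lambda>_. dK) dF 0 i w)"
proof -
  interpret dc: double_complex "X d" "\<lambda>_. dK" dF by (rule double_complex)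
  have "dc.homology_class 0 i (const_chain i v) \<longleftrightarrow>
     v \<in> tensor_cycles irrelevant_ideal ds D i \<and> v \<notin> tensor_boundaries irrelevant_ideal ds D i"
    if "v \<in> free_mod_degree (ds i) d" for v
    using tensor_cycles_iff[OF that] tensor_boundaries_iff[OF that] const_chain_in_X[OF that]
    by (auto simp: dc.homology_class_def dc.boundary_def)
  moreover have "w \<in> X d 0 i" if "dc.homology_class 0 i w" for w using that by (simp add: dc.homology_class_def)
  ultimately show ?thesis by (metis X_0_const_chain)
qed

section \<open>Koszul homology over the quotient as homology in resolution degree zero\<close>

definition chain_aug :: "('v set \<Rightarrow> nat \<Rightarrow> ('v, 'k) mpoly) \<Rightarrow> 'v set \<Rightarrow> ('v, 'k) mpoly" where
  "chain_aug w T = aug (w T)"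

lemma chain_aug_dK: "chain_aug (dK w) T = koszul (chain_aug w) T"
  by (simp add: chain_aug_def[abs_def] aug_def dK_def koszul_sum_mult)

lemma chain_aug_diff: "chain_aug (w - z) T = chain_aug w T - chain_aug z T"
  by (simp add: chain_aug_def aug_def algebra_simps sum_subtractf)

lemma koszul_chain_chain_aug:
  assumes "w \<in> X d p 0" shows "koszul_chain p d (chain_aug w)"
  unfolding koszul_chain_iff
proof (intro allI conjI impI)
  fix S
  have "homog_part (ds 0) (d - int p) (w S) = w S" using assms by (simp add: X_iff)
  then have "hcomp (d - int p) (chain_aug w S) = chain_aug w S"
    unfolding chain_aug_def by (metis aug_homog_part)
  then show "homogeneous (d - int p) (chain_aug w S)" by (metis homogeneous_hcomp)
  assume "chain_aug w S \<noteq> 0"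
  then show "card S = p" using assms by (auto simp: X_iff chain_aug_def aug_def)
qed

text \<open>Preimages chosen separately for each \<open>S\<close> may have wrong degrees and occur
  at sets of wrong size. Cutting them down is harmless, since \<open>f\<close> is already of the
  right kind and \<open>I\<close> is closed under homogeneous components.\<close>

lemma chain_aug_lift:
  assumes f: "koszul_chain p d f"
  shows "\<exists>w\<in>X d p 0. \<forall>S. f S - chain_aug w S \<in> I"
proof -
  have "\<forall>S. \<exists>v. f S - aug v \<in> I" using aug_surj by blast
  from choice[OF this] obtain u where u: "\<And>S. f S - aug (u S) \<in> I" by blast
  define w where "w S = (if card S = p then homog_part (ds 0) (d - int p) (u S) else (\<lambda>_. 0))" for S
  have "w \<in> X d p 0"
    unfolding X_iff w_def by (auto simp: supported_def homog_part_def hcomp_homogeneous fun_eq_iff)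
  moreover have "f S - chain_aug w S \<in> I" for S
  proof (cases "card S = p")
    case True
    have "f S - chain_aug w S = hcomp (d - int p) (f S - aug (u S))"
      using True f by (simp add: chain_aug_def w_def aug_homog_part hcomp_diff hcomp_homogeneous koszul_chain_iff)
    then show ?thesis using u I_hcomp by simp
  next
    case False
    then have "f S = 0" using f by (auto simp: koszul_chain_iff)
    then show ?thesis using False by (simp add: chain_aug_def w_def aug_def I_0)
  qed
  ultimately show ?thesis by blast
qed

text \<open>Exactness at the start of the resolution: modulo \<open>I\<close>, the kernel of the
  augmentation is the image of \<open>dF 0\<close>.\<close>

lemma chain_aug_in_I_iff:
  assumes w: "w \<in> X d p 0"
  shows "(\<forall>S. chain_aug w S \<in> I) \<longleftrightarrow> (\<exists>t\<in>X d p 1. w = dF 0 t)"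
proof -
  have sup: "supported 0 (w S)" for S using w by (simp add: X_def)
  show ?thesis
  proof
    assume "\<forall>S. chain_aug w S \<in> I"
    then show "\<exists>t\<in>X d p 1. w = dF 0 t" using dF_lift[OF w] aug_in_I_iff[OF sup] by (simp add: chain_aug_def)
  next
    assume "\<exists>t\<in>X d p 1. w = dF 0 t"
    then show "\<forall>S. chain_aug w S \<in> I" using aug_in_I_iff[OF sup] by (auto simp: chain_aug_def dF_def)
  qed
qed

text \<open>Representatives move along \<open>chain_aug\<close> in one direction and along lifts in
  the other. A lift is correct up to an error with coefficients in \<open>I\<close>, and
  \<open>koszul\<close> keeps such errors in \<open>I\<close>.\<close>

lemma homology_class_iff_koszul:
  "(\<exists>w. double_complex.homology_class (X d) (\<lambda>_. dK) dF i 0 w) \<longleftrightarrow> koszul_homology_nonzero I i d"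
proof
  interpret dc: double_complex "X d" "\<lambda>_. dK" dF by (rule double_complex)
  assume "\<exists>w. dc.homology_class i 0 w"
  then obtain w where w: "w \<in> X d i 0" "\<not> dc.boundary i 0 w"
    and cyc: "\<And>p. i = Suc p \<Longrightarrow> \<exists>t\<in>X d p 1. dK w = dF 0 t" by (auto simp: dc.homology_class_def)
  have "koszul (chain_aug w) S \<in> I" for S
  proof (cases i)
    case 0
    then show ?thesis using koszul_chain_0 koszul_chain_chain_aug[OF w(1)] I_0 by metis
  next
    case (Suc p)
    then have "dK w \<in> X d p 0" using w dK_closed by blast
    then show ?thesis using chain_aug_in_I_iff cyc[OF Suc] chain_aug_dK by metis
  qed
  moreover have "\<not> (\<exists>h. koszul_chain (Suc i) d h \<and> (\<forall>S. chain_aug w S - koszul h S \<in> I))"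
  proof
    assume "\<exists>h. koszul_chain (Suc i) d h \<and> (\<forall>S. chain_aug w S - koszul h S \<in> I)"
    then obtain h where h: "koszul_chain (Suc i) d h" "\<And>S. chain_aug w S - koszul h S \<in> I" by blast
    obtain u where u: "u \<in> X d (Suc i) 0" "\<And>S. h S - chain_aug u S \<in> I" using chain_aug_lift[OF h(1)] by blast
    have "chain_aug (w - dK u) S \<in> I" for S
    proof -
      have "koszul (\<lambda>T. h T - chain_aug u T) S \<in> I" using u(2) by (rule I_koszul)
      then have "(chain_aug w S - koszul h S) + (koszul h S - koszul (chain_aug u) S) \<in> I"
        using h(2) by (intro I_add) (simp_all add: koszul_diff)
      then show ?thesis by (simp add: chain_aug_diff chain_aug_dK)
    qed
    moreover have "w - dK u \<in> X d i 0" using w u dK_closed X_diff by blast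
    ultimately obtain t where t: "t \<in> X d i 1" "w - dK u = dF 0 t" using chain_aug_in_I_iff by blast
    then have "w = dK u + dF 0 t" by (metis add.commute diff_add_cancel)
    then show False using w(2) u(1) t(1) by (auto simp: dc.boundary_def)
  qed
  ultimately show "koszul_homology_nonzero I i d"
    using koszul_chain_chain_aug[OF w(1)] unfolding koszul_homology_nonzero_def by blast
next
  interpret dc: double_complex "X d" "\<lambda>_. dK" dF by (rule double_complex)
  assume "koszul_homology_nonzero I i d"
  then obtain f where f: "koszul_chain i d f" "\<And>S. koszul f S \<in> I"
    and nb: "\<And>h. koszul_chain (Suc i) d h \<Longrightarrow> \<exists>S. f S - koszul h S \<notin> I"
    unfolding koszul_homology_nonzero_def by blast
  obtain w where w: "w \<in> X d i 0" "\<And>S. f S - chain_aug w S \<in> I" using chain_aug_lift[OF f(1)] by blast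
  have "\<exists>t\<in>X d p 1. dK w = dF 0 t" if "i = Suc p" for p
  proof -
    have "koszul (\<lambda>T. f T - chain_aug w T) S \<in> I" for S using w(2) by (rule I_koszul)
    then have "koszul f S - koszul (\<lambda>T. f T - chain_aug w T) S \<in> I" for S using f(2) I_diff by blast
    then have "chain_aug (dK w) S \<in> I" for S by (simp add: koszul_diff chain_aug_dK)
    moreover have "dK w \<in> X d p 0" using w that dK_closed by blast
    ultimately show ?thesis using chain_aug_in_I_iff by blast
  qed
  moreover have "\<not> dc.boundary i 0 w"
  proof
    assume "dc.boundary i 0 w"
    then obtain u t where ut: "u \<in> X d (Suc i) 0" "t \<in> X d i 1" "w = dK u + dF 0 t"
      by (auto simp: dc.boundary_def)
    have "dF 0 t \<in> X d i 0" using ut dF_closed by simp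
    then have t: "chain_aug (dF 0 t) S \<in> I" for S using chain_aug_in_I_iff ut(2) by blast
    have "f S - koszul (chain_aug u) S \<in> I" for S
    proof -
      have "w - dK u = dF 0 t" using ut by simp
      then have "chain_aug w S - koszul (chain_aug u) S \<in> I" using t chain_aug_diff chain_aug_dK by metis
      then have "(f S - chain_aug w S) + (chain_aug w S - koszul (chain_aug u) S) \<in> I" using w(2) I_add by blast
      then show ?thesis by simp
    qed
    then show False using nb koszul_chain_chain_aug[OF ut(1)] by blast
  qed
  ultimately have "dc.homology_class i 0 w" using w(1) by (auto simp: dc.homology_class_def)
  then show "\<exists>w. dc.homology_class i 0 w" by blast
qed

text \<open>The class travels along the antidiagonal from \<open>(0, i)\<close> to
  \<open>(i, 0)\<close>. The right side does not mention the resolution, so nonvanishing is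
  independent of it.\<close>

theorem tor_iff_koszul:
  "(\<exists>v\<in>free_mod_degree (ds i) d. v \<in> tensor_cycles irrelevant_ideal ds D i \<and> v \<notin> tensor_boundaries irrelevant_ideal ds D i)
   \<longleftrightarrow> koszul_homology_nonzero I i d"
proof -
  interpret dc: double_complex "X d" "\<lambda>_. dK" dF by (rule double_complex)
  show ?thesis using dc.homology_class_shift[of 0 0 i] by (simp add: tor_iff_homology_class homology_class_iff_koszul)
qed

end

section \<open>The Taylor resolution of an edge ideal\<close>

definition edge_subsets :: "'v::finite set set \<Rightarrow> nat \<Rightarrow> 'v set set list" where
  "edge_subsets E q = (SOME xs. set xs = {S. S \<subseteq> E \<and> card S = q} \<and> distinct xs)"

lemma edge_subsets: "set (edge_subsets E q) = {S. S \<subseteq> E \<and> card S = q}" "distinct (edge_subsets E q)"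
proof -
  have "\<exists>xs. set xs = {S. S \<subseteq> E \<and> card S = q} \<and> distinct xs" by (rule finite_distinct_list) simp
  from someI_ex[OF this] show "set (edge_subsets E q) = {S. S \<subseteq> E \<and> card S = q}" "distinct (edge_subsets E q)"
    by (simp_all add: edge_subsets_def)
qed

lemma edge_subsets_0: "edge_subsets E 0 = [{}]"
proof -
  have set: "set (edge_subsets E 0) = {{}}" by (auto simp: edge_subsets)
  then have "length (edge_subsets E 0) = 1" using distinct_card[OF edge_subsets(2)[of E 0]] by simp
  then obtain x where "edge_subsets E 0 = [x]" by (auto simp: length_Suc_conv)
  then show ?thesis using set by simp
qed

definition taylor_degrees :: "'v::finite set set \<Rightarrow> nat \<Rightarrow> int list" where
  "taylor_degrees E q = map (\<lambda>S. int (card (\<Union>S))) (edge_subsets E q)"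

text \<open>At most one summand of an entry is nonzero, since \<open>insert j S\<close> determines
  \<open>j\<close> outside \<open>S\<close>; the sum spares the choice of that
  \<open>j\<close>.\<close>

definition taylor_mat :: "'v::finite set set \<Rightarrow> nat \<Rightarrow> ('v, 'k::field) mpoly mat" where
  "taylor_mat E q = mat (length (edge_subsets E q)) (length (edge_subsets E (Suc q))) (\<lambda>(a, b).
     let S = edge_subsets E q ! a in
     \<Sum>j\<in>E - S. if insert j S = edge_subsets E (Suc q) ! b
       then Poly_Mapping.single (sqfree (j - \<Union>S)) (sgn_at j S) else 0)"

definition chain_vec :: "'v::finite set set \<Rightarrow> nat \<Rightarrow> ('v set set \<Rightarrow> ('v, 'k::field) mpoly) \<Rightarrow> ('v, 'k) mpoly vec" where
  "chain_vec E q f = vec (length (edge_subsets E q)) (\<lambda>b. f (edge_subsets E q ! b))"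

lemma chain_vec_carrier [simp]: "chain_vec E q f \<in> carrier_vec (length (edge_subsets E q))"
  by (simp add: chain_vec_def)

lemma sum_edge_subsets:
  "(\<Sum>b<length (edge_subsets E q). g (edge_subsets E q ! b)) = (\<Sum>S | S \<subseteq> E \<and> card S = q. g S)"
proof -
  have "bij_betw ((!) (edge_subsets E q)) {..<length (edge_subsets E q)} {S. S \<subseteq> E \<and> card S = q}"
    using bij_betw_nth[OF edge_subsets(2) refl refl] by (simp add: edge_subsets(1))
  then show ?thesis by (rule sum.reindex_bij_betw)
qed

lemma chain_vec_surj:
  assumes "v \<in> carrier_vec (length (edge_subsets E q))"
  shows "\<exists>f. taylor_chain E q f \<and> v = chain_vec E q f"
proof -
  let ?L = "edge_subsets E q"
  define f where "f S = (\<Sum>b<length ?L. if ?L ! b = S then v $ b else 0)" for S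
  have "f (?L ! a) = v $ a" if "a < length ?L" for a
  proof -
    have "f (?L ! a) = (\<Sum>b<length ?L. if b = a then v $ b else 0)"
      unfolding f_def using that edge_subsets(2)[of E q] by (intro sum.cong) (auto simp: nth_eq_iff_index_eq)
    then show ?thesis using that by simp
  qed
  then have "v = chain_vec E q f" using assms by (intro eq_vecI) (auto simp: chain_vec_def)
  moreover have "taylor_chain E q f"
    unfolding taylor_chain_def
  proof (intro allI impI)
    fix S assume "f S \<noteq> 0"
    then obtain b where "b \<in> {..<length ?L}" "(if ?L ! b = S then v $ b else 0) \<noteq> 0"
      unfolding f_def by (rule sum.not_neutral_contains_not_neutral)
    then have "b < length ?L" "?L ! b = S" by (auto split: if_splits)
    then have "S \<in> set ?L" by auto
    then show "S \<subseteq> E \<and> card S = q" by (simp add: edge_subsets)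
  qed
  ultimately show ?thesis by blast
qed

lemma chain_vec_eq_0_iff:
  assumes "taylor_chain E q f"
  shows "chain_vec E q f = 0\<^sub>v (length (edge_subsets E q)) \<longleftrightarrow> (\<forall>S. f S = 0)"
proof
  assume z: "chain_vec E q f = 0\<^sub>v (length (edge_subsets E q))"
  show "\<forall>S. f S = 0"
  proof (rule allI, rule ccontr)
    fix S assume "f S \<noteq> 0"
    then have "S \<in> set (edge_subsets E q)" using assms by (simp add: edge_subsets taylor_chain_def)
    then obtain b where "b < length (edge_subsets E q)" "S = edge_subsets E q ! b" by (metis in_set_conv_nth)
    moreover from this have "chain_vec E q f $ b = f S" by (simp add: chain_vec_def)
    ultimately show False using z \<open>f S \<noteq> 0\<close> by simp
  qed
qed (auto simp: chain_vec_def)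

lemma taylor_mat_chain_vec:
  "taylor_mat E q *\<^sub>v chain_vec E (Suc q) f = chain_vec E q (taylor_diff (\<lambda>e. e) E f)"
  for f :: "'v::finite set set \<Rightarrow> ('v, 'k::field) mpoly"
proof (rule eq_vecI)
  fix a assume "a < dim_vec (chain_vec E q (taylor_diff (\<lambda>e. e) E f))"
  then have a: "a < length (edge_subsets E q)" by (simp add: chain_vec_def)
  define S where "S = edge_subsets E q ! a"
  have S: "S \<subseteq> E" "card S = q" using a edge_subsets(1)[of E q] nth_mem by (auto simp: S_def)
  let ?s = "\<lambda>j. Poly_Mapping.single (sqfree (j - \<Union>S)) (sgn_at j S) :: ('v, 'k) mpoly"
  have "(taylor_mat E q *\<^sub>v chain_vec E (Suc q) f) $ a
      = (\<Sum>b<length (edge_subsets E (Suc q)). (\<Sum>j\<in>E - S. if insert j S = edge_subsets E (Suc q) ! b then ?s j else 0)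
          * f (edge_subsets E (Suc q) ! b))"
    unfolding S_def using a by (simp add: taylor_mat_def chain_vec_def scalar_prod_def Let_def lessThan_atLeast0)
  also have "\<dots> = (\<Sum>T | T \<subseteq> E \<and> card T = Suc q. (\<Sum>j\<in>E - S. if insert j S = T then ?s j else 0) * f T)"
    by (rule sum_edge_subsets)
  also have "\<dots> = (\<Sum>T | T \<subseteq> E \<and> card T = Suc q. \<Sum>j\<in>E - S. if insert j S = T then ?s j * f T else 0)"
    by (simp add: sum_distrib_right if_distrib[where f = "\<lambda>x. x * _"] cong: if_cong)
  also have "\<dots> = (\<Sum>j\<in>E - S. \<Sum>T | T \<subseteq> E \<and> card T = Suc q. if insert j S = T then ?s j * f T else 0)"
    by (rule sum.swap)
  also have "\<dots> = (\<Sum>j\<in>E - S. ?s j * f (insert j S))"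
    using S by (intro sum.cong refl) (subst sum.delta', auto)
  also have "\<dots> = chain_vec E q (taylor_diff (\<lambda>e. e) E f) $ a"
    using a by (simp add: chain_vec_def taylor_diff_def S_def)
  finally show "(taylor_mat E q *\<^sub>v chain_vec E (Suc q) f) $ a = chain_vec E q (taylor_diff (\<lambda>e. e) E f) $ a" .
qed (simp add: taylor_mat_def chain_vec_def)

lemma taylor_mat_graded: "(taylor_mat E q :: ('v::finite, 'k::field) mpoly mat) \<in> graded_mat (taylor_degrees E q) (taylor_degrees E (Suc q))"
  unfolding graded_mat_def
proof (intro CollectI conjI allI impI)
  show "(taylor_mat E q :: ('v, 'k) mpoly mat) \<in> carrier_mat (length (taylor_degrees E q)) (length (taylor_degrees E (Suc q)))"
    by (simp add: taylor_mat_def taylor_degrees_def)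
next
  fix a b assume ab: "a < length (taylor_degrees E q)" "b < length (taylor_degrees E (Suc q))"
  let ?S = "edge_subsets E q ! a"
  let ?T = "edge_subsets E (Suc q) ! b"
  have "card (\<Union>(insert j ?S)) = card (\<Union>?S) + card (j - \<Union>?S)" for j
  proof -
    have "\<Union>(insert j ?S) = \<Union>?S \<union> (j - \<Union>?S)" by auto
    then show ?thesis by (metis Diff_disjoint card_Un_disjoint finite)
  qed
  then have "int (card (\<Union>?T)) - int (card (\<Union>?S)) = int (card (j - \<Union>?S))" if "insert j ?S = ?T" for j
    by (simp flip: that)
  then have "homogeneous (int (card (\<Union>?T)) - int (card (\<Union>?S)))
      (if insert j ?S = ?T then Poly_Mapping.single (sqfree (j - \<Union>?S)) (sgn_at j ?S :: 'k) else 0)" for j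
    by (cases "insert j ?S = ?T") (simp_all add: homogeneous_single)
  then have "homogeneous (int (card (\<Union>?T)) - int (card (\<Union>?S))) (\<Sum>j\<in>E - ?S.
      if insert j ?S = ?T then Poly_Mapping.single (sqfree (j - \<Union>?S)) (sgn_at j ?S :: 'k) else 0)"
    by (rule homogeneous_sum)
  then show "homogeneous (taylor_degrees E (Suc q) ! b - taylor_degrees E q ! a) (taylor_mat E q $$ (a, b) :: ('v, 'k) mpoly)"
    using ab by (simp add: taylor_mat_def taylor_degrees_def Let_def)
qed

lemma edge_ideal_diff: "p \<in> edge_ideal E \<Longrightarrow> q \<in> edge_ideal E \<Longrightarrow> p - q \<in> edge_ideal E"
  for p q :: "('v::finite, 'k::field) mpoly"
  unfolding edge_ideal_def ideal_gen_def by (rule ring_module.span_diff)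

lemma edge_ideal_mult: "p \<in> edge_ideal E \<Longrightarrow> r * p \<in> edge_ideal E"
  for p r :: "('v::finite, 'k::field) mpoly"
  unfolding edge_ideal_def ideal_gen_def by (rule ring_module.span_scale)

lemma edge_ideal_hcomp: "simple_graph E \<Longrightarrow> p \<in> edge_ideal E \<Longrightarrow> hcomp d p \<in> edge_ideal E"
  for p :: "('v::finite, 'k::field) mpoly"
  by (auto simp: edge_ideal_iff in_keys_iff lookup_hcomp split: if_splits)

lemma taylor_resolution:
  assumes E: "simple_graph (E :: 'v::finite set set)"
  shows "graded_free_resolution (edge_ideal E :: ('v, 'k::field) mpoly set) (taylor_degrees E) (taylor_mat E) (vec 1 (\<lambda>_. 1))"
proof -
  let ?d = "taylor_diff (\<lambda>e. e) E :: ('v set set \<Rightarrow> ('v, 'k) mpoly) \<Rightarrow> _"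
  let ?D = "taylor_mat E :: nat \<Rightarrow> ('v, 'k) mpoly mat"
  let ?e = "vec 1 (\<lambda>_. 1) :: ('v, 'k) mpoly vec"
  have len [simp]: "length (taylor_degrees E q) = length (edge_subsets E q)" for q
    by (simp add: taylor_degrees_def)
  have dims [simp]: "dim_row (?D q) = length (edge_subsets E q)" "dim_col (?D q) = length (edge_subsets E (Suc q))" for q
    by (simp_all add: taylor_mat_def)
  have e0: "taylor_degrees E 0 = [0]" by (simp add: taylor_degrees_def edge_subsets_0)
  have aug: "?e \<bullet> chain_vec E 0 f = f {}" for f :: "'v set set \<Rightarrow> ('v, 'k) mpoly"
    by (simp add: scalar_prod_def chain_vec_def edge_subsets_0)
  have exact: "mat_image (?D (Suc i)) = mat_kernel (?D i)" for i
  proof (intro equalityI subsetI)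
    fix x assume "x \<in> mat_image (?D (Suc i))"
    then obtain f where "x = ?D (Suc i) *\<^sub>v chain_vec E (Suc (Suc i)) f"
      unfolding mat_image_def using chain_vec_surj[of _ E "Suc (Suc i)"] by auto
    then have x: "x = chain_vec E (Suc i) (?d f)" by (simp add: taylor_mat_chain_vec)
    then have "?D i *\<^sub>v x = chain_vec E i (\<lambda>_. 0)"
      by (simp add: taylor_mat_chain_vec taylor_diff_diff[abs_def])
    also have "\<dots> = 0\<^sub>v (length (edge_subsets E i))" by (auto simp: chain_vec_def)
    finally show "x \<in> mat_kernel (?D i)" using x by (simp add: mat_kernel_def)
  next
    fix x assume "x \<in> mat_kernel (?D i)"
    then have x: "x \<in> carrier_vec (length (edge_subsets E (Suc i)))" "?D i *\<^sub>v x = 0\<^sub>v (length (edge_subsets E i))"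
      by (auto simp: mat_kernel_def)
    from chain_vec_surj[OF x(1)] obtain f where f: "taylor_chain E (Suc i) f" "x = chain_vec E (Suc i) f" by blast
    have "chain_vec E i (?d f) = 0\<^sub>v (length (edge_subsets E i))" using x f by (simp add: taylor_mat_chain_vec)
    then have cyc: "?d f S = 0" for S using chain_vec_eq_0_iff[OF taylor_chain_diff[OF f(1)]] by blast
    \<comment> \<open>In positive degree \<open>S\<close> is nonempty, and any of its own edges
      divides the multidegree.\<close>
    have "\<exists>j\<in>E. j \<subseteq> Poly_Mapping.keys (n + sqfree (\<Union>((\<lambda>e. e) ` S)))" if "n \<in> Poly_Mapping.keys (f S)" for S n
    proof -
      have "f S \<noteq> 0" using that by auto
      then have "S \<subseteq> E" "card S = Suc i" using f(1) by (auto simp: taylor_chain_def)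
      then obtain j where "j \<in> S" "j \<in> E" by (metis card.empty ex_in_conv nat.distinct(1) subsetD)
      then show ?thesis by (force simp: in_keys_iff lookup_add)
    qed
    \<comment> \<open>Kernel elements need not be homogeneous, hence the flag \<open>False\<close>;
      the degree 0 is a dummy.\<close>
    from taylor_exact[of E "Suc i" f "\<lambda>e. e" 0 False, OF f(1) _ cyc this]
    obtain h where "?d h = f" by auto
    then have "x = ?D (Suc i) *\<^sub>v chain_vec E (Suc (Suc i)) h" using f by (simp add: taylor_mat_chain_vec)
    then show "x \<in> mat_image (?D (Suc i))" by (auto simp: mat_image_def)
  qed
  have exact0: "mat_image (?D 0) = {v \<in> free_mod (taylor_degrees E 0). ?e \<bullet> v \<in> edge_ideal E}"
  proof (intro equalityI subsetI)
    fix x assume "x \<in> mat_image (?D 0)"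
    then obtain f where "x = ?D 0 *\<^sub>v chain_vec E (Suc 0) f"
      unfolding mat_image_def using chain_vec_surj[of _ E "Suc 0"] by auto
    then have x: "x = chain_vec E 0 (?d f)" by (simp add: taylor_mat_chain_vec)
    have "\<exists>j\<in>E. j \<subseteq> Poly_Mapping.keys n" if "n \<in> Poly_Mapping.keys (?d f {})" for n
    proof (rule ccontr)
      assume "\<not> (\<exists>j\<in>E. j \<subseteq> Poly_Mapping.keys n)"
      then have "Poly_Mapping.lookup (?d f {}) n = 0" by (simp add: taylor_diff_def lookup_sum lookup_sqfree_times)
      then show False using that by (simp add: in_keys_iff)
    qed
    then have "?d f {} \<in> edge_ideal E" by (simp add: edge_ideal_iff[OF E])
    then show "x \<in> {v \<in> free_mod (taylor_degrees E 0). ?e \<bullet> v \<in> edge_ideal E}"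
      by (simp add: x aug free_mod_def del: One_nat_def)
  next
    fix x assume "x \<in> {v \<in> free_mod (taylor_degrees E 0). ?e \<bullet> v \<in> edge_ideal E}"
    then have x: "x \<in> carrier_vec (length (edge_subsets E 0))" "?e \<bullet> x \<in> edge_ideal E" by (auto simp: free_mod_def)
    from chain_vec_surj[OF x(1)] obtain f where f: "taylor_chain E 0 f" "x = chain_vec E 0 f" by blast
    have f0: "S = {}" if "f S \<noteq> 0" for S using f(1) that by (auto simp: taylor_chain_def)
    have "f (insert j S) = 0" for j S using f0[of "insert j S"] by auto
    then have cyc: "?d f S = 0" for S by (simp add: taylor_diff_def)
    have "f {} \<in> edge_ideal E" using x f by (simp add: aug del: One_nat_def)
    then have I: "\<exists>j\<in>E. j \<subseteq> Poly_Mapping.keys n" if "n \<in> Poly_Mapping.keys (f {})" for n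
      using that by (simp add: edge_ideal_iff[OF E])
    \<comment> \<open>The empty set offers no edge of its own; here divisibility comes from
      membership in the ideal.\<close>
    have "\<exists>j\<in>E. j \<subseteq> Poly_Mapping.keys (n + sqfree (\<Union>((\<lambda>e. e) ` S)))" if "n \<in> Poly_Mapping.keys (f S)" for S n
    proof -
      have "S = {}" using that f0[of S] by (cases "f S = 0") simp_all
      then show ?thesis using I that by simp
    qed
    from taylor_exact[of E 0 f "\<lambda>e. e" 0 False, OF f(1) _ cyc this]
    obtain h where "?d h = f" by auto
    then have "x = ?D 0 *\<^sub>v chain_vec E (Suc 0) h" using f by (simp add: taylor_mat_chain_vec)
    then show "x \<in> mat_image (?D 0)" by (auto simp: mat_image_def)
  qed
  have surj: "\<exists>v\<in>free_mod (taylor_degrees E 0). p - ?e \<bullet> v \<in> edge_ideal E" for p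
  proof
    show "chain_vec E 0 (\<lambda>_. p) \<in> free_mod (taylor_degrees E 0)" by (simp add: free_mod_def)
    show "p - ?e \<bullet> chain_vec E 0 (\<lambda>_. p) \<in> edge_ideal E" by (simp add: aug edge_ideal_iff[OF E] del: One_nat_def)
  qed
  show ?thesis
    unfolding graded_free_resolution_def using taylor_mat_graded exact exact0 surj
    by (auto simp: e0 homogeneous_def mon_degree_def)
qed

text \<open>One direction applies the comparison to the given resolution, the other to the Taylor
  resolution.\<close>

lemma tor_nonzero_iff_koszul:
  assumes "simple_graph (E :: 'v::finite set set)"
  shows "tor_nonzero (edge_ideal E :: ('v, 'k::field) mpoly set) irrelevant_ideal i d
     \<longleftrightarrow> koszul_homology_nonzero (edge_ideal E :: ('v, 'k) mpoly set) i d"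
proof -
  have "graded_resolution (edge_ideal E :: ('v, 'k) mpoly set) ds D e"
    if "graded_free_resolution (edge_ideal E :: ('v, 'k) mpoly set) ds D e" for ds D e
    using that assms
    by unfold_locales (simp_all add: edge_ideal_diff edge_ideal_mult edge_ideal_hcomp, simp add: edge_ideal_iff)
  then show ?thesis
    unfolding tor_nonzero_def using graded_resolution.tor_iff_koszul taylor_resolution[OF assms] by blast
qed

section \<open>Koszul homology of edge ideals of complements of triangle-free graphs\<close>

text \<open>In a multidegree with an exponent at least two at \<open>x\<close>, the support of the monomial does not see
  whether \<open>x\<close> belongs to the exterior part, so that coning with \<open>x\<close> contracts the complex.\<close>

lemma koszul_homology_bound:
  fixes E :: "'v::finite set set"
  assumes E: "simple_graph E" and dense: "\<And>W. 3 \<le> card W \<Longrightarrow> \<exists>e\<in>E. e \<subseteq> W"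
    and nz: "koszul_homology_nonzero (edge_ideal E :: ('v, 'k::field) mpoly set) i d"
  shows "d \<le> int i + 2"
proof (rule ccontr)
  assume d: "\<not> d \<le> int i + 2"
  obtain f :: "'v set \<Rightarrow> ('v, 'k) mpoly" where f: "koszul_chain i d f" "\<And>S. koszul f S \<in> edge_ideal E"
    and nb: "\<And>h. koszul_chain (Suc i) d h \<Longrightarrow> \<exists>S. f S - koszul h S \<notin> edge_ideal E"
    using nz unfolding koszul_homology_nonzero_def by blast
  let ?U = "\<lambda>v::'v. {v}"
  define c where "c a = (if \<exists>x. 2 \<le> Poly_Mapping.lookup a x then Some (SOME x. 2 \<le> Poly_Mapping.lookup a x) else None)"
    for a :: "'v \<Rightarrow>\<^sub>0 nat"
  have c: "2 \<le> Poly_Mapping.lookup a x" if "c a = Some x" for a x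
    using that someI_ex[of "\<lambda>x. 2 \<le> Poly_Mapping.lookup a x"] by (auto simp: c_def split: if_splits)
  have c': "?U x \<subseteq> Poly_Mapping.keys a" if "c a = Some x" for a x
    using c[OF that] by (auto simp: in_keys_iff)
  let ?h = "taylor_homotopy ?U c f"
  have "koszul_chain (Suc i) d ?h"
    using f(1) by (auto simp: koszul_chain_def intro: taylor_chain_homotopy taylor_homogeneous_homotopy)
  moreover have "f S - koszul ?h S \<in> edge_ideal E" for S
    unfolding edge_ideal_iff[OF E]
  proof
    fix n assume "n \<in> Poly_Mapping.keys (f S - koszul ?h S)"
    then have "Poly_Mapping.lookup (f S - koszul ?h S) n \<noteq> 0" by (simp add: in_keys_iff)
    moreover define a where "a = n + sqfree S"
    ultimately have ne: "multicoeff ?U f a S \<noteq> multicoeff ?U (koszul ?h) a S"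
      by (simp add: lookup_minus lookup_eq_multicoeff[of _ S n ?U])
    show "\<exists>e\<in>E. e \<subseteq> Poly_Mapping.keys n"
    proof (cases "c a")
      case None
      \<comment> \<open>The homotopy is switched off in squarefree multidegrees, so the term comes
        from \<open>f\<close>; its degree \<open>d - i\<close> is at least 3 and, being squarefree,
        equals the size of its support.\<close>
      have "multicoeff ?U ?h a S' = 0" for S'
        using None c' by (subst multicoeff_taylor_homotopy) auto
      then have "multicoeff ?U f a S \<noteq> 0" using ne by (simp add: multicoeff_taylor_diff simplicial_diff_def)
      then have n: "n \<in> Poly_Mapping.keys (f S)"
        by (simp add: in_keys_iff lookup_eq_multicoeff[of f S n ?U] a_def)
      have "card S = i" using n f(1) by (force simp: koszul_chain_iff)
      then have "int (mon_degree n) = d - int i" using n f(1) by (auto simp: koszul_chain_iff homogeneous_def)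
      then have "3 \<le> mon_degree n" using d by simp
      moreover have "Poly_Mapping.lookup n v \<le> 1" for v
      proof -
        have "\<not> 2 \<le> Poly_Mapping.lookup a v" using None by (auto simp: c_def split: if_splits)
        then show ?thesis by (simp add: a_def lookup_add)
      qed
      then have "mon_degree n \<le> card (Poly_Mapping.keys n)"
        unfolding mon_degree_def using sum_bounded_above[of "Poly_Mapping.keys n" "Poly_Mapping.lookup n" 1] by simp
      ultimately show ?thesis using dense[of "Poly_Mapping.keys n"] by simp
    next
      case (Some x)
      \<comment> \<open>\<open>f\<close> is a cycle only modulo the ideal, so the homotopy identity
        leaves this remainder.\<close>
      have "multicoeff ?U (taylor_homotopy ?U c (koszul f)) a S \<noteq> 0"
        using taylor_homotopy_identity[of c a x UNIV ?U f S] Some c'[OF Some] ne by auto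
      then have "simplicial_cone x (multicoeff ?U (koszul f) a) S \<noteq> 0"
        using Some c' by (subst (asm) multicoeff_taylor_homotopy) auto
      then have x: "x \<in> S" and "multicoeff ?U (koszul f) a (S - {x}) \<noteq> 0"
        by (auto simp: simplicial_cone_def split: if_splits)
      then have "a - sqfree (S - {x}) \<in> Poly_Mapping.keys (koszul f (S - {x}))"
        by (auto simp: multicoeff_def in_keys_iff split: if_splits)
      then obtain e where e: "e \<in> E" "e \<subseteq> Poly_Mapping.keys (a - sqfree (S - {x}))"
        using f(2)[of "S - {x}"] by (auto simp: edge_ideal_iff[OF E])
      \<comment> \<open>The left exponent is \<open>n\<close> with one more \<open>x\<close>. As
        \<open>x\<close> has exponent at least 2 in \<open>a\<close> and \<open>S\<close> accounts
        for one of these, \<open>x\<close> already lies in the support of \<open>n\<close>.\<close>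
      have "Poly_Mapping.keys (a - sqfree (S - {x})) \<subseteq> Poly_Mapping.keys n"
        using c[OF Some] x by (auto simp: in_keys_iff lookup_minus lookup_add a_def split: if_splits)
      then show ?thesis using e by blast
    qed
  qed
  ultimately show False using nb by blast
qed

lemma complement_pair_iff: "x \<noteq> y \<Longrightarrow> {x, y} \<in> graph_complement G \<longleftrightarrow> {x, y} \<notin> G"
  by (simp add: graph_complement_def nsets_def)

text \<open>A cycle of \<open>G\<close> with vertex set \<open>W\<close> pairs with the multidegree of \<open>W\<close>. The signs \<open>sgn_at v (W - {v})\<close>
  turn the Koszul differential there into the coboundary of \<open>G\<close>, whose sum around the cycle vanishes.\<close>

lemma koszul_homology_of_cycle:
  fixes G :: "'v::finite set set"
  assumes G: "simple_graph G" "triangle_free G" and cyc: "graph_cycle G c"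
  shows "koszul_homology_nonzero (edge_ideal (graph_complement G) :: ('v, 'k::field) mpoly set)
     (length c - 2) (int (length c))"
proof -
  let ?E = "graph_complement G" and ?n = "length c"
  have E: "simple_graph ?E" by (auto simp: simple_graph_def graph_complement_def)
  have c: "3 \<le> ?n" "distinct c" "\<And>l. l < ?n \<Longrightarrow> {c ! l, c ! (Suc l mod ?n)} \<in> G"
    using cyc by (auto simp: graph_cycle_def)
  define W where "W = set c"
  define u where "u l = c ! l" for l
  define v where "v l = c ! (Suc l mod ?n)" for l
  define T where "T l = W - {u l, v l}" for l
  have uv: "u l \<in> W" "v l \<in> W" "u l \<noteq> v l" "{u l, v l} \<in> G" if "l < ?n" for l
  proof -
    have m: "Suc l mod ?n < ?n" using c(1) by (intro mod_less_divisor) linarith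
    show "u l \<in> W" "v l \<in> W" "{u l, v l} \<in> G" using that m c(3) by (auto simp: u_def v_def W_def)
    have "l \<noteq> Suc l mod ?n" using that c(1) by (cases "Suc l = ?n") auto
    then show "u l \<noteq> v l" using that m c(2) by (simp add: u_def v_def nth_eq_iff_index_eq)
  qed
  \<comment> \<open>An edge met twice would have to be traversed back at once, which a cycle of
    length at least 3 excludes.\<close>
  have T0: "T l \<noteq> T 0" if "l < ?n" "l \<noteq> 0" for l
  proof
    assume "T l = T 0"
    moreover have "W - T k = {u k, v k}" if "k < ?n" for k using uv[OF that] by (auto simp: T_def)
    ultimately have "{u l, v l} = {u 0, v 0}" using that by (metis gr0I not_less_zero)
    then have "u l = u 0 \<or> u l = v 0 \<and> v l = u 0" by (metis doubleton_eq_iff)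
    moreover have "Suc l mod ?n < ?n" "1 < ?n" "0 < ?n"
      using c(1) by (auto intro!: mod_less_divisor)
    ultimately have "l = 0 \<or> l = 1 \<and> Suc l mod ?n = 0"
      using that c(2) by (auto simp: u_def v_def nth_eq_iff_index_eq)
    moreover have "Suc 1 mod ?n = 2" using c(1) by simp
    ultimately show False using that by auto
  qed
  have n0: "0 < ?n" using c(1) by linarith
  \<comment> \<open>The indicator cochain of the first edge: the edge is the polynomial part, the
    other vertices of the cycle are the exterior part.\<close>
  define f :: "'v set \<Rightarrow> ('v, 'k) mpoly" where
    "f S = (if S = T 0 then Poly_Mapping.single (sqfree {u 0, v 0}) 1 else 0)" for S
  have cardW: "card W = ?n" using c(2) by (simp add: W_def distinct_card)
  have "card (T 0) = ?n - 2"
    using uv[OF n0] cardW unfolding T_def by (subst card_Diff_subset) auto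
  then have "koszul_chain (?n - 2) (int ?n) f"
    using c(1) uv(3)[OF n0] by (auto simp: koszul_chain_iff f_def intro!: homogeneous_single)
  \<comment> \<open>Every 1-cochain of a graph without triangles is a cocycle: a third vertex
    \<open>j\<close> is not adjacent to both ends, so the new monomial lies in the ideal.\<close>
  moreover have "koszul f S \<in> edge_ideal ?E" for S
    unfolding edge_ideal_iff[OF E]
  proof
    fix m assume "m \<in> Poly_Mapping.keys (koszul f S)"
    then have "Poly_Mapping.lookup (koszul f S) m \<noteq> 0" by (simp add: in_keys_iff)
    then obtain j where j: "j \<notin> S"
      "Poly_Mapping.lookup (Poly_Mapping.single (sqfree ({j} - (\<Union>v\<in>S. {v}))) (sgn_at j S) * f (insert j S)) m \<noteq> 0"
      unfolding taylor_diff_def lookup_sum by (meson DiffD2 sum.not_neutral_contains_not_neutral)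
    then have ins: "insert j S = T 0" by (auto simp: f_def split: if_splits)
    have "{j} - (\<Union>v\<in>S. {v}) = {j}" using j(1) by auto
    with j ins have m: "m = sqfree {j} + sqfree {u 0, v 0}"
      by (auto simp: f_def mult_single lookup_single when_def split: if_splits)
    have "j \<in> T 0" using ins by blast
    then have "j \<noteq> u 0" "j \<noteq> v 0" by (auto simp: T_def)
    moreover have "{u 0, v 0} \<in> G" "u 0 \<noteq> v 0" using uv[OF n0] by auto
    ultimately have "{j, u 0} \<in> ?E \<or> {j, v 0} \<in> ?E"
      using G(2) unfolding triangle_free_def by (metis complement_pair_iff)
    then show "\<exists>e\<in>?E. e \<subseteq> Poly_Mapping.keys m"
      by (elim disjE) (rule bexI, auto simp: m in_keys_iff lookup_add)+
  qed
  moreover have False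
    if h: "koszul_chain (Suc (?n - 2)) (int ?n) h" "\<And>S. f S - koszul h S \<in> edge_ideal ?E" for h
  proof -
    let ?U = "\<lambda>v::'v. {v}"
    define g where "g = multicoeff ?U h (sqfree W)"
    define t :: "'v \<Rightarrow> 'k" where "t x = sgn_at x (W - {x})" for x
    define Y where "Y x = t x * g (W - {x})" for x
    define s where "s l = sgn_at (u l) (T l) * t (v l)" for l
    \<comment> \<open>Monomials of edges of \<open>G\<close> lie outside the ideal, so on them the
      congruence is an equality: up to sign, the coboundary of \<open>Y\<close> would be the
      indicator of the first edge.\<close>
    have key: "s l * (if l = 0 then 1 else 0) = Y (v l) - Y (u l)" if l: "l < ?n" for l
    proof -
      have sub: "sqfree {u l, v l} + sqfree (T l) = sqfree W"
        using uv[OF l] by (intro poly_mapping_eqI) (auto simp: lookup_add T_def)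
      have "sqfree {u l, v l} \<notin> Poly_Mapping.keys (f (T l) - koszul h (T l))"
      proof
        assume "sqfree {u l, v l} \<in> Poly_Mapping.keys (f (T l) - koszul h (T l))"
        then obtain e where e: "e \<in> ?E" "e \<subseteq> {u l, v l}"
          using h(2)[of "T l"] by (force simp: edge_ideal_iff[OF E])
        then have "card e = 2" by (auto simp: graph_complement_def nsets_def)
        then have "e = {u l, v l}" using e(2) uv(3)[OF l] by (intro card_subset_eq) auto
        then show False using e(1) uv(4)[OF l] by (simp add: graph_complement_def)
      qed
      then have "Poly_Mapping.lookup (f (T l)) (sqfree {u l, v l}) = Poly_Mapping.lookup (koszul h (T l)) (sqfree {u l, v l})"
        by (simp add: in_keys_iff lookup_minus)
      also have "\<dots> = simplicial_diff UNIV g (T l)"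
        by (simp add: lookup_eq_multicoeff[of "koszul h" "T l" _ ?U] sub multicoeff_taylor_diff g_def)
      \<comment> \<open>Only the two ends of the edge keep \<open>insert j (T l)\<close> inside
        \<open>W\<close>; at all other sets \<open>multicoeff\<close> is zero.\<close>
      also have "\<dots> = (\<Sum>j\<in>{u l, v l}. sgn_at j (T l) * g (insert j (T l)))"
        unfolding simplicial_diff_def
        by (rule sum.mono_neutral_right) (use uv[OF l] in \<open>auto simp: T_def g_def multicoeff_def\<close>)
      also have "\<dots> = sgn_at (u l) (T l) * g (W - {v l}) + sgn_at (v l) (T l) * g (W - {u l})"
      proof -
        have "insert (u l) (T l) = W - {v l}" "insert (v l) (T l) = W - {u l}" using uv[OF l] by (auto simp: T_def)
        then show ?thesis using uv(3)[OF l] by simp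
      qed
      finally have 1: "(if l = 0 then 1 else 0) = sgn_at (u l) (T l) * g (W - {v l}) + sgn_at (v l) (T l) * g (W - {u l})"
        using T0[OF l] by (auto simp: f_def split: if_splits)
      have "sgn_at (u l) (T l) * sgn_at (v l) (insert (u l) (T l)) = - (sgn_at (v l) (T l) * (sgn_at (u l) (insert (v l) (T l)) :: 'k))"
        using uv(3)[OF l] by (intro sgn_at_anticommute) (auto simp: T_def)
      moreover have "insert (u l) (T l) = W - {v l}" "insert (v l) (T l) = W - {u l}" using uv[OF l] by (auto simp: T_def)
      ultimately have s': "s l = - (sgn_at (v l) (T l) * t (u l))" by (simp add: s_def t_def)
      have "s l * (sgn_at (u l) (T l) * g (W - {v l})) = Y (v l)"
      proof -
        have "s l * (sgn_at (u l) (T l) * g (W - {v l}))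
            = (sgn_at (u l) (T l) * sgn_at (u l) (T l)) * (t (v l) * g (W - {v l}))"
          unfolding s_def by (simp only: mult_ac)
        then show ?thesis by (simp add: Y_def)
      qed
      moreover have "s l * (sgn_at (v l) (T l) * g (W - {u l})) = - Y (u l)"
      proof -
        have "s l * (sgn_at (v l) (T l) * g (W - {u l}))
            = - ((sgn_at (v l) (T l) * sgn_at (v l) (T l)) * (t (u l) * g (W - {u l})))"
          unfolding s' mult_minus_left by (simp only: mult_ac)
        then show ?thesis by (simp add: Y_def)
      qed
      ultimately show ?thesis unfolding 1 by (simp add: distrib_left)
    qed
    obtain m where m: "?n = Suc m" using n0 by (cases ?n) auto
    have "s 0 = (\<Sum>l<?n. s l * (if l = 0 then 1 else 0))"
      using n0 by (simp add: if_distrib[where f = "\<lambda>x. _ * x"] cong: if_cong)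
    also have "\<dots> = (\<Sum>l<?n. Y (v l)) - (\<Sum>l<?n. Y (u l))" by (simp add: key sum_subtractf)
    \<comment> \<open>The successors \<open>v l\<close> run through the same vertices as the
      \<open>u l\<close>, so the coboundary sums to zero around the cycle, leaving
      \<open>s 0 = 0\<close>.\<close>
    also have "(\<Sum>l<?n. Y (v l)) = (\<Sum>l<m. Y (c ! Suc l)) + Y (c ! 0)"
      by (simp add: m v_def)
    also have "\<dots> = (\<Sum>l<?n. Y (u l))" by (simp add: m u_def sum.lessThan_Suc_shift del: sum.lessThan_Suc)
    finally have "s 0 = 0" by simp
    \<comment> \<open>\<open>s 0\<close> is a product of signs and hence a unit, so its vanishing is
      absurd in every characteristic.\<close>
    then have "t (v 0) * (sgn_at (u 0) (T 0) * s 0) = 0" by simp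
    moreover have "sgn_at (u 0) (T 0) * s 0 = t (v 0)" by (simp add: s_def)
    ultimately show False by (simp add: t_def)
  qed
  ultimately show ?thesis unfolding koszul_homology_nonzero_def by blast
qed

lemma complement_of_triangle_free:
  fixes G :: "'v::finite set set"
  assumes "triangle_free G" "3 \<le> card W"
  shows "\<exists>e\<in>graph_complement G. e \<subseteq> W"
proof -
  obtain V where "V \<subseteq> W" "card V = 3" by (metis assms(2) obtain_subset_with_card_n)
  then obtain x y z where xyz: "{x, y, z} \<subseteq> W" "x \<noteq> y" "y \<noteq> z" "x \<noteq> z" by (auto simp: card_3_iff)
  then have "{x, y} \<in> graph_complement G \<or> {y, z} \<in> graph_complement G \<or> {x, z} \<in> graph_complement G"
    using assms(1) unfolding triangle_free_def by (metis complement_pair_iff)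
  then show ?thesis using xyz(1) by (metis empty_subsetI insert_subset)
qed

theorem corollary4p6:
  fixes G :: "'v::finite set set"
  assumes "simple_graph G" and "triangle_free G" and "\<not> forest G"
  shows "reg_quotient (edge_ideal (graph_complement G) :: ('v, 'k::field) mpoly set) = 2"
  unfolding reg_quotient_def
proof (rule Greatest_equality)
  have E: "simple_graph (graph_complement G)" by (auto simp: simple_graph_def graph_complement_def)
  obtain c where c: "graph_cycle G c" using assms(3) by (auto simp: forest_def)
  \<comment> \<open>The subtraction on \<open>nat\<close> is truncated; a cycle has length at least
    3, so it is exact here.\<close>
  then have "int (length c - 2) + 2 = int (length c)" by (auto simp: graph_cycle_def)
  then show "\<exists>i. tor_nonzero (edge_ideal (graph_complement G) :: ('v, 'k) mpoly set) irrelevant_ideal i (int i + 2)"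
    unfolding tor_nonzero_iff_koszul[OF E]
    by (intro exI[of _ "length c - 2"]) (simp only: koszul_homology_of_cycle[OF assms(1,2) c])
  fix j
  assume "\<exists>i. tor_nonzero (edge_ideal (graph_complement G) :: ('v, 'k) mpoly set) irrelevant_ideal i (int i + j)"
  then obtain i where "koszul_homology_nonzero (edge_ideal (graph_complement G) :: ('v, 'k) mpoly set) i (int i + j)"
    by (auto simp: tor_nonzero_iff_koszul[OF E])
  then have "int i + j \<le> int i + 2"
    using koszul_homology_bound[OF E] complement_of_triangle_free[OF assms(2)] by blast
  then show "j \<le> 2" by simp
qed

end
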